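(* Let $q\in\Bbbk$ and let $H$ be a connected $q$-Hopf algebra over $\Bbbk$, with finite-dimensional homogeneous components $H_m$, that is cofree as a graded coalgebra, and let $S$ be its antipode. For each nonnegative integer $m$, $$\operatorname{trace}\bigl(S|_{H_m}\bigr)=\sum_{\alpha\vDash m}(-1)^{\ell(\alpha)}\,\mathrm{pal}(\alpha)\,q^{\mathrm{inv}(\alpha)},$$ where the sum is over all compositions $\alpha$ of $m$.
   Context: $\Bbbk$ is a field of characteristic zero and $q\in\Bbbk$ is fixed; $q^0=1$ also for $q=0$. A $q$-Hopf algebra is a Hopf monoid in the lax braided monoidal category of graded vector spaces with lax braiding $x\otimes y\mapsto q^{mn}\,y\otimes x$ for $x,y$ homogeneous of degrees $m,n$. Concretely: a graded vector space $H=\bigoplus_{m\ge0}H_m$ that is a graded algebra and a graded coalgebra, such that the counit is an algebra map, $\Delta(1)=1\otimes1$, and $\Delta:H\to H\otimes H$ is an algebra map when $H\otimes H$ has the product $(x\otimes y)(x'\otimes y')=q^{|y||x'|}\,xx'\otimes yy'$ on homogeneous elements, and having an antipode $S$ (the inverse of the identity under convolution $P\ast Q=\mu\circ(P\otimes Q)\circ\Delta$), which preserves degree. It is connected if $\dim H_0=1$ (the antipode then exists automatically). $H$ is cofree as a graded coalgebra if it is isomorphic, as a graded coalgebra, to the deconcatenation coalgebra $\bigoplus_{k\ge0}V^{\otimes k}$ on a graded vector space $V$, with coproduct $\Delta(x_1\cdots x_k)=1\otimes(x_1\cdots x_k)+\sum_{i=1}^{k-1}(x_1\cdots x_i)\otimes(x_{i+1}\cdots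 x_k)+(x_1\cdots x_k)\otimes1$; then $V\cong\mathcal P(H)=\{x\in H:\Delta(x)=1\otimes x+x\otimes1\}$. Take $V=\mathcal P(H)$ and put $v_n=\dim V_n$ for $n\ge1$. For a composition $\alpha=(a_1,\dots,a_k)$ of $m$ (a sequence of positive integers with sum $m$; the empty composition is the only composition of $0$), write $\alpha\vDash m$, $\ell(\alpha)=k$, $\widetilde\alpha=(a_k,\dots,a_1)$, $\mathrm{inv}(\alpha)=\sum_{1\le i<j\le k}a_ia_j$, and $\mathrm{pal}(\alpha)=\prod_{i=1}^{\lceil k/2\rceil}v_{a_i}$ if $\alpha=\widetilde\alpha$, $\mathrm{pal}(\alpha)=0$ otherwise. (With a homogeneous basis of $V$ as alphabet, this is the number of palindromic words whose sequence of letter weights is $\alpha$.) *)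

theory Defs
  imports Complex_Main "HOL-Library.Function_Algebras"
begin

section \<open>Linear extension and traces\<close>

text \<open>
  The linear map with \<open>e i \<mapsto> F i\<close> for \<open>i \<in> I\<close>, evaluated at a linear combination of the \<open>e i\<close>.
  The value is independent of the chosen combination whenever such a linear map exists;
  see \<open>linear_extension_eq\<close>.  Vectors outside the span of \<open>e ` I\<close> get an unspecified value.
\<close>

definition lin_comb :: "('k::field \<Rightarrow> 'w::ab_group_add \<Rightarrow> 'w) \<Rightarrow> ('i \<Rightarrow> 'w) \<Rightarrow> ('k \<times> 'i) list \<Rightarrow> 'w" where
  "lin_comb s e L = (\<Sum>(c, i)\<leftarrow>L. s c (e i))"

definition linear_extension ::
  "('k::field \<Rightarrow> 'w::ab_group_add \<Rightarrow> 'w) \<Rightarrow> ('k \<Rightarrow> 'u::ab_group_add \<Rightarrow> 'u) \<Rightarrow>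
   'i set \<Rightarrow> ('i \<Rightarrow> 'w) \<Rightarrow> ('i \<Rightarrow> 'u) \<Rightarrow> 'w \<Rightarrow> 'u" where
  "linear_extension sW sU I e F t =
     lin_comb sU F (SOME L. snd ` set L \<subseteq> I \<and> t = lin_comb sW e L)"

definition subspace_trace ::
  "('k::field \<Rightarrow> 'h::ab_group_add \<Rightarrow> 'h) \<Rightarrow> 'h set \<Rightarrow> ('h \<Rightarrow> 'h) \<Rightarrow> 'k" where
  "subspace_trace s U f =
     (let B = (SOME B. \<not> module.dependent s B \<and> module.span s B = U)
      in \<Sum>b\<in>B. module.representation s B (f b) b)"

definition fun_scale :: "'k::field \<Rightarrow> ('i \<Rightarrow> 'k) \<Rightarrow> 'i \<Rightarrow> 'k" where
  "fun_scale c t = (\<lambda>i. c * t i)"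

section \<open>Tensor products\<close>

text \<open>
  A tensor is represented by its values under all bilinear forms; \<open>A \<otimes> B\<close> is the span of the
  pure tensors, which is the algebraic tensor product because over a field \<open>A \<otimes> B\<close> embeds
  into its double dual.
\<close>

type_synonym ('a, 'b, 'k) tensor = "('a \<Rightarrow> 'b \<Rightarrow> 'k) \<Rightarrow> 'k"

definition bilinear_map ::
  "('k::field \<Rightarrow> 'a::ab_group_add \<Rightarrow> 'a) \<Rightarrow> ('k \<Rightarrow> 'b::ab_group_add \<Rightarrow> 'b) \<Rightarrow>
   ('k \<Rightarrow> 'u::ab_group_add \<Rightarrow> 'u) \<Rightarrow> ('a \<Rightarrow> 'b \<Rightarrow> 'u) \<Rightarrow> bool" where
  "bilinear_map sA sB sU F \<longleftrightarrow>
     (\<forall>y. Vector_Spaces.linear sA sU (\<lambda>x. F x y)) \<and> (\<forall>x. Vector_Spaces.linear sB sU (F x))"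

definition tensor ::
  "('k::field \<Rightarrow> 'a::ab_group_add \<Rightarrow> 'a) \<Rightarrow> ('k \<Rightarrow> 'b::ab_group_add \<Rightarrow> 'b) \<Rightarrow>
   'a \<Rightarrow> 'b \<Rightarrow> ('a, 'b, 'k) tensor" where
  "tensor sA sB x y = (\<lambda>F. if bilinear_map sA sB (*) F then F x y else 0)"

definition tensor_lift ::
  "('k::field \<Rightarrow> 'a::ab_group_add \<Rightarrow> 'a) \<Rightarrow> ('k \<Rightarrow> 'b::ab_group_add \<Rightarrow> 'b) \<Rightarrow>
   ('k \<Rightarrow> 'u::ab_group_add \<Rightarrow> 'u) \<Rightarrow> ('a \<Rightarrow> 'b \<Rightarrow> 'u) \<Rightarrow> ('a, 'b, 'k) tensor \<Rightarrow> 'u" where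
  "tensor_lift sA sB sU F =
     linear_extension fun_scale sU UNIV (\<lambda>(x, y). tensor sA sB x y) (\<lambda>(x, y). F x y)"

definition tensor_map ::
  "('k::field \<Rightarrow> 'a::ab_group_add \<Rightarrow> 'a) \<Rightarrow> ('k \<Rightarrow> 'b::ab_group_add \<Rightarrow> 'b) \<Rightarrow>
   ('k \<Rightarrow> 'c::ab_group_add \<Rightarrow> 'c) \<Rightarrow> ('k \<Rightarrow> 'd::ab_group_add \<Rightarrow> 'd) \<Rightarrow>
   ('a \<Rightarrow> 'c) \<Rightarrow> ('b \<Rightarrow> 'd) \<Rightarrow> ('a, 'b, 'k) tensor \<Rightarrow> ('c, 'd, 'k) tensor" where
  "tensor_map sA sB sC sD f g =
     tensor_lift sA sB fun_scale (\<lambda>x y. tensor sC sD (f x) (g y))"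

text \<open>\<open>(x \<otimes> y) \<otimes> z \<mapsto> x \<otimes> (y \<otimes> z)\<close>\<close>

definition tensor_assoc ::
  "('k::field \<Rightarrow> 'a::ab_group_add \<Rightarrow> 'a) \<Rightarrow> ('k \<Rightarrow> 'b::ab_group_add \<Rightarrow> 'b) \<Rightarrow>
   ('k \<Rightarrow> 'c::ab_group_add \<Rightarrow> 'c) \<Rightarrow>
   (('a, 'b, 'k) tensor, 'c, 'k) tensor \<Rightarrow> ('a, ('b, 'c, 'k) tensor, 'k) tensor" where
  "tensor_assoc sA sB sC =
     linear_extension fun_scale fun_scale UNIV
       (\<lambda>(x, y, z). tensor fun_scale sC (tensor sA sB x y) z)
       (\<lambda>(x, y, z). tensor sA fun_scale x (tensor sB sC y z))"

section \<open>Graded vector spaces, algebras and coalgebras\<close>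

locale graded_vector_space = vector_space scale
  for scale :: "'k::field \<Rightarrow> 'h::ab_group_add \<Rightarrow> 'h" +
  fixes H :: "nat \<Rightarrow> 'h set"
  assumes subspace_component: "subspace (H m)"
    and direct_sum:
      "\<exists>!c. (\<forall>n. c n \<in> H n) \<and> finite {n. c n \<noteq> 0} \<and> x = (\<Sum>n | c n \<noteq> 0. c n)"

text \<open>Associativity, distributivity and the unit laws come from the class \<open>ring_1\<close>.\<close>

locale graded_algebra = graded_vector_space scale H
  for scale :: "'k::field \<Rightarrow> 'h::ring_1 \<Rightarrow> 'h" and H :: "nat \<Rightarrow> 'h set" +
  assumes scale_mult_left: "scale c x * y = scale c (x * y)"
    and scale_mult_right: "x * scale c y = scale c (x * y)"
    and one_degree: "1 \<in> H 0"
    and mult_degree: "x \<in> H m \<Longrightarrow> y \<in> H n \<Longrightarrow> x * y \<in> H (m + n)"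

locale graded_coalgebra = graded_vector_space scale H
  for scale :: "'k::field \<Rightarrow> 'h::ab_group_add \<Rightarrow> 'h" and H :: "nat \<Rightarrow> 'h set" +
  fixes \<Delta> :: "'h \<Rightarrow> ('h, 'h, 'k) tensor" and \<epsilon> :: "'h \<Rightarrow> 'k"
  assumes linear_comult: "Vector_Spaces.linear scale fun_scale \<Delta>"
    and linear_counit: "Vector_Spaces.linear scale (*) \<epsilon>"
    and comult_degree:
      "x \<in> H m \<Longrightarrow>
       \<Delta> x \<in> module.span fun_scale
         {tensor scale scale y z | y z i j. i + j = m \<and> y \<in> H i \<and> z \<in> H j}"
    and counit_degree: "x \<in> H m \<Longrightarrow> m > 0 \<Longrightarrow> \<epsilon> x = 0"
    and coassociative:
      "tensor_assoc scale scale scale (tensor_map scale scale fun_scale scale \<Delta> id (\<Delta> x)) =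
       tensor_map scale scale scale fun_scale id \<Delta> (\<Delta> x)"
    and counit_left: "tensor_lift scale scale scale (\<lambda>y z. scale (\<epsilon> y) z) (\<Delta> x) = x"
    and counit_right: "tensor_lift scale scale scale (\<lambda>y z. scale (\<epsilon> z) y) (\<Delta> x) = x"

definition primitives ::
  "('k::field \<Rightarrow> 'h::ring_1 \<Rightarrow> 'h) \<Rightarrow> ('h \<Rightarrow> ('h, 'h, 'k) tensor) \<Rightarrow> 'h set" where
  "primitives scale \<Delta> = {x. \<Delta> x = tensor scale scale 1 x + tensor scale scale x 1}"

section \<open>The deconcatenation coalgebra\<close>

text \<open>
  As for tensors, the word \<open>x\<^sub>1\<cdots>x\<^sub>k\<close> is represented by its values under all forms that are
  multilinear on the words of each length, and \<open>\<Oplus>\<^sub>k V\<^bsup>\<otimes>k\<^esup>\<close> is the span of the words.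
\<close>

type_synonym ('v, 'k) word_tensor = "('v list \<Rightarrow> 'k) \<Rightarrow> 'k"

definition multilinear_map ::
  "('k::field \<Rightarrow> 'v::ab_group_add \<Rightarrow> 'v) \<Rightarrow> ('k \<Rightarrow> 'u::ab_group_add \<Rightarrow> 'u) \<Rightarrow>
   ('v list \<Rightarrow> 'u) \<Rightarrow> bool" where
  "multilinear_map sV sU F \<longleftrightarrow>
     (\<forall>us ws. Vector_Spaces.linear sV sU (\<lambda>x. F (us @ x # ws)))"

definition word ::
  "('k::field \<Rightarrow> 'v::ab_group_add \<Rightarrow> 'v) \<Rightarrow> 'v list \<Rightarrow> ('v, 'k) word_tensor" where
  "word sV w = (\<lambda>F. if multilinear_map sV (*) F then F w else 0)"

definition word_degree ::
  "('k::field \<Rightarrow> 'v::ab_group_add \<Rightarrow> 'v) \<Rightarrow> (nat \<Rightarrow> 'v set) \<Rightarrow> nat \<Rightarrow> ('v, 'k) word_tensor set" where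
  "word_degree sV V m =
     module.span fun_scale
       {word sV w | w ns. list_all2 (\<lambda>x n. x \<in> V n) w ns \<and> sum_list ns = m}"

definition deconcatenation ::
  "('k::field \<Rightarrow> 'v::ab_group_add \<Rightarrow> 'v) \<Rightarrow> ('v, 'k) word_tensor \<Rightarrow>
   (('v, 'k) word_tensor, ('v, 'k) word_tensor, 'k) tensor" where
  "deconcatenation sV =
     linear_extension fun_scale fun_scale UNIV (word sV)
       (\<lambda>w. \<Sum>i\<le>length w. tensor fun_scale fun_scale (word sV (take i w)) (word sV (drop i w)))"

definition word_counit ::
  "('k::field \<Rightarrow> 'v::ab_group_add \<Rightarrow> 'v) \<Rightarrow> ('v, 'k) word_tensor \<Rightarrow> 'k" where
  "word_counit sV =
     linear_extension fun_scale (*) UNIV (word sV) (\<lambda>w. if w = [] then 1 else 0)"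

text \<open>\<open>f\<close> is an isomorphism of graded coalgebras onto the deconcatenation coalgebra on \<open>V\<close>.\<close>

definition deconcatenation_iso ::
  "('k::field \<Rightarrow> 'h::ab_group_add \<Rightarrow> 'h) \<Rightarrow> (nat \<Rightarrow> 'h set) \<Rightarrow> ('h \<Rightarrow> ('h, 'h, 'k) tensor) \<Rightarrow>
   ('h \<Rightarrow> 'k) \<Rightarrow> ('k \<Rightarrow> 'v::ab_group_add \<Rightarrow> 'v) \<Rightarrow> (nat \<Rightarrow> 'v set) \<Rightarrow>
   ('h \<Rightarrow> ('v, 'k) word_tensor) \<Rightarrow> bool" where
  "deconcatenation_iso scale H \<Delta> \<epsilon> sV V f \<longleftrightarrow>
     Vector_Spaces.linear scale fun_scale f \<and>
     bij_betw f UNIV (module.span fun_scale (range (word sV))) \<and>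
     (\<forall>m. f ` H m = word_degree sV V m) \<and>
     (\<forall>x. deconcatenation sV (f x) = tensor_map scale scale fun_scale fun_scale f f (\<Delta> x)) \<and>
     (\<forall>x. word_counit sV (f x) = \<epsilon> x)"

section \<open>Hopf algebras with respect to the q-braiding\<close>

definition homogeneous :: "(nat \<Rightarrow> 'h set) \<Rightarrow> 'h set" where
  "homogeneous H = (\<Union>m. H m)"

text \<open>For homogeneous \<open>x \<noteq> 0\<close> this is the degree; the value at \<open>0\<close> is irrelevant.\<close>

definition degree_of :: "(nat \<Rightarrow> 'h set) \<Rightarrow> 'h \<Rightarrow> nat" where
  "degree_of H x = (LEAST m. x \<in> H m)"

text \<open>
  The bilinear product \<open>(x \<otimes> y)(x' \<otimes> y') = q\<^bsup>|y||x'|\<^esup> xx' \<otimes> yy'\<close>; the formula prescribes it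
  on homogeneous elements, whose pure tensors span.
\<close>

definition braided_mult ::
  "('k::field \<Rightarrow> 'h::ring_1 \<Rightarrow> 'h) \<Rightarrow> (nat \<Rightarrow> 'h set) \<Rightarrow> 'k \<Rightarrow>
   ('h, 'h, 'k) tensor \<Rightarrow> ('h, 'h, 'k) tensor \<Rightarrow> ('h, 'h, 'k) tensor" where
  "braided_mult scale H q t t' =
     (let I = homogeneous H \<times> homogeneous H; e = (\<lambda>(x, y). tensor scale scale x y) in
      linear_extension fun_scale fun_scale I e
        (\<lambda>(x, y). linear_extension fun_scale fun_scale I e
           (\<lambda>(x', y'). fun_scale (q ^ (degree_of H y * degree_of H x'))
              (tensor scale scale (x * x') (y * y'))) t') t)"

definition convolution ::
  "('k::field \<Rightarrow> 'h::ring_1 \<Rightarrow> 'h) \<Rightarrow> ('h \<Rightarrow> ('h, 'h, 'k) tensor) \<Rightarrow>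
   ('h \<Rightarrow> 'h) \<Rightarrow> ('h \<Rightarrow> 'h) \<Rightarrow> 'h \<Rightarrow> 'h" where
  "convolution scale \<Delta> P Q x =
     tensor_lift scale scale scale (*) (tensor_map scale scale scale scale P Q (\<Delta> x))"

locale q_hopf_algebra =
  graded_algebra scale H + graded_coalgebra scale H \<Delta> \<epsilon>
  for scale :: "'k::field \<Rightarrow> 'h::ring_1 \<Rightarrow> 'h" and H :: "nat \<Rightarrow> 'h set"
    and \<Delta> :: "'h \<Rightarrow> ('h, 'h, 'k) tensor" and \<epsilon> :: "'h \<Rightarrow> 'k" +
  fixes q :: 'k and S :: "'h \<Rightarrow> 'h"
  assumes counit_one: "\<epsilon> 1 = 1"
    and counit_mult: "\<epsilon> (x * y) = \<epsilon> x * \<epsilon> y"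
    and comult_one: "\<Delta> 1 = tensor scale scale 1 1"
    and comult_mult: "\<Delta> (x * y) = braided_mult scale H q (\<Delta> x) (\<Delta> y)"
    and linear_antipode: "Vector_Spaces.linear scale scale S"
    and antipode_degree: "S ` H m \<subseteq> H m"
    and antipode_left: "convolution scale \<Delta> S id x = scale (\<epsilon> x) 1"
    and antipode_right: "convolution scale \<Delta> id S x = scale (\<epsilon> x) 1"

section \<open>Compositions\<close>

definition compositions :: "nat \<Rightarrow> nat list set" where
  "compositions m = {\<alpha>. 0 \<notin> set \<alpha> \<and> sum_list \<alpha> = m}"

definition comp_inv :: "nat list \<Rightarrow> nat" where
  "comp_inv \<alpha> = (\<Sum>j<length \<alpha>. \<Sum>i<j. \<alpha> ! i * \<alpha> ! j)"

definition pal :: "(nat \<Rightarrow> nat) \<Rightarrow> nat list \<Rightarrow> nat" where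
  "pal v \<alpha> = (if \<alpha> = rev \<alpha> then \<Prod>i<(length \<alpha> + 1) div 2. v (\<alpha> ! i) else 0)"

section \<open>Well-definedness of linear extensions\<close>

lemma vector_space_fun_scale: "vector_space (fun_scale :: 'k::field \<Rightarrow> ('i \<Rightarrow> 'k) \<Rightarrow> 'i \<Rightarrow> 'k)"
  by unfold_locales (auto simp: fun_scale_def fun_eq_iff algebra_simps)

lemma fun_scale_apply: "fun_scale c t i = c * t i"
  by (simp add: fun_scale_def)

lemma vector_space_field: "vector_space ((*) :: 'k::field \<Rightarrow> 'k \<Rightarrow> 'k)"
  by unfold_locales (auto simp: algebra_simps)

lemma linear_eqI_functionals:
  fixes s :: "'k::field \<Rightarrow> 'u::ab_group_add \<Rightarrow> 'u"
  assumes "vector_space s"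
    and "\<And>\<phi>. Vector_Spaces.linear s (*) \<phi> \<Longrightarrow> \<phi> u = \<phi> v"
  shows "u = v"
proof (rule ccontr)
  assume "u \<noteq> v"
  interpret vector_space_pair s "(*) :: 'k \<Rightarrow> 'k \<Rightarrow> 'k"
    using assms(1) vector_space_field by (simp add: vector_space_pair_def)
  have "vs1.independent {u - v}" using \<open>u \<noteq> v\<close> by simp
  from linear_independent_extend[OF this, of "\<lambda>_. 1"] obtain \<phi>
    where \<phi>: "Vector_Spaces.linear s (*) \<phi>" "\<phi> (u - v) = 1" by auto
  with assms(2)[OF \<phi>(1)] linear_diff[OF \<phi>(1)] show False by simp
qed

lemma linear_lin_comb:
  assumes "Vector_Spaces.linear s s' \<phi>"
  shows "\<phi> (lin_comb s e L) = lin_comb s' (\<phi> \<circ> e) L"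
proof -
  interpret Vector_Spaces.linear s s' \<phi> by fact
  show ?thesis by (induction L) (auto simp: lin_comb_def zero add scale)
qed

lemma lin_comb_cong: "(\<And>i. i \<in> snd ` set L \<Longrightarrow> e i = e' i) \<Longrightarrow> lin_comb s e L = lin_comb s e' L"
  unfolding lin_comb_def by (intro arg_cong[of _ _ sum_list] map_cong) force+

lemma linear_extension_eq:
  assumes U: "vector_space sU"
    and ex: "\<And>\<phi>. Vector_Spaces.linear sU (*) \<phi> \<Longrightarrow>
      \<exists>\<psi>. Vector_Spaces.linear sW (*) \<psi> \<and> (\<forall>i\<in>I. \<psi> (e i) = \<phi> (F i))"
    and L: "snd ` set L \<subseteq> I"
  shows "linear_extension sW sU I e F (lin_comb sW e L) = lin_comb sU F L"
proof -
  define K where "K = (SOME K. snd ` set K \<subseteq> I \<and> lin_comb sW e L = lin_comb sW e K)"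
  have K: "snd ` set K \<subseteq> I" "lin_comb sW e L = lin_comb sW e K"
    using someI[of "\<lambda>K. snd ` set K \<subseteq> I \<and> lin_comb sW e L = lin_comb sW e K" L] L
    by (auto simp: K_def)
  have "lin_comb sU F K = lin_comb sU F L"
  proof (rule linear_eqI_functionals[OF U])
    fix \<phi> assume \<phi>: "Vector_Spaces.linear sU (*) \<phi>"
    from ex[OF \<phi>] obtain \<psi> where \<psi>: "Vector_Spaces.linear sW (*) \<psi>" "\<And>i. i\<in>I \<Longrightarrow> \<psi> (e i) = \<phi> (F i)"
      by blast
    have *: "\<phi> (lin_comb sU F M) = \<psi> (lin_comb sW e M)" if "snd ` set M \<subseteq> I" for M
      unfolding linear_lin_comb[OF \<phi>] linear_lin_comb[OF \<psi>(1)]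
      using that by (intro lin_comb_cong) (auto simp: \<psi>(2) subset_iff)
    show "\<phi> (lin_comb sU F K) = \<phi> (lin_comb sU F L)"
      using *[OF K(1)] *[OF L] K(2) by simp
  qed
  then show ?thesis by (simp add: linear_extension_def K_def)
qed

lemma linear_apply: "Vector_Spaces.linear fun_scale (*) (\<lambda>t. t i)"
  using vector_space_fun_scale vector_space_field
  by (auto simp: Vector_Spaces.linear_iff fun_scale_def)

lemma linear_compose_functional:
  "Vector_Spaces.linear s s' f \<Longrightarrow> Vector_Spaces.linear s' s'' g \<Longrightarrow> Vector_Spaces.linear s s'' (\<lambda>x. g (f x))"
  by (auto simp: Vector_Spaces.linear_iff)

lemma tensor_lift_eq:
  assumes F: "bilinear_map sA sB sU F"
  shows "tensor_lift sA sB sU F (lin_comb fun_scale (\<lambda>(x, y). tensor sA sB x y) L) =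
    lin_comb sU (\<lambda>(x, y). F x y) L"
  unfolding tensor_lift_def
proof (rule linear_extension_eq)
  show "vector_space sU" using F by (auto simp: bilinear_map_def Vector_Spaces.linear_iff)
  fix \<phi> assume \<phi>: "Vector_Spaces.linear sU (*) \<phi>"
  have "bilinear_map sA sB (*) (\<lambda>x y. \<phi> (F x y))"
    unfolding bilinear_map_def
  proof (intro conjI allI)
    show "Vector_Spaces.linear sA (*) (\<lambda>x. \<phi> (F x y))" for y
      using F \<phi> linear_compose_functional[of sA sU "\<lambda>x. F x y" "(*)" \<phi>]
      by (auto simp: bilinear_map_def)
    show "Vector_Spaces.linear sB (*) (\<lambda>y. \<phi> (F x y))" for x
      using F \<phi> linear_compose_functional[of sB sU "F x" "(*)" \<phi>]
      by (auto simp: bilinear_map_def)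
  qed
  then show "\<exists>\<psi>. Vector_Spaces.linear fun_scale (*) \<psi> \<and>
      (\<forall>i\<in>UNIV. \<psi> (case i of (x, y) \<Rightarrow> tensor sA sB x y) = \<phi> (case i of (x, y) \<Rightarrow> F x y))"
    by (intro exI[of _ "\<lambda>t. t (\<lambda>x y. \<phi> (F x y))"] conjI linear_apply) (auto simp: tensor_def)
qed simp

lemma word_extension_eq:
  assumes U: "vector_space sU" and F: "multilinear_map sV sU F"
  shows "linear_extension fun_scale sU UNIV (word sV) F (lin_comb fun_scale (word sV) L) =
    lin_comb sU F L"
proof (rule linear_extension_eq[OF U])
  fix \<phi> assume \<phi>: "Vector_Spaces.linear sU (*) \<phi>"
  have "multilinear_map sV (*) (\<lambda>w. \<phi> (F w))"
    unfolding multilinear_map_def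
  proof (intro allI)
    show "Vector_Spaces.linear sV (*) (\<lambda>x. \<phi> (F (us @ x # ws)))" for us ws
      using F \<phi> linear_compose_functional[of sV sU "\<lambda>x. F (us @ x # ws)" "(*)" \<phi>]
      by (auto simp: multilinear_map_def)
  qed
  then show "\<exists>\<psi>. Vector_Spaces.linear fun_scale (*) \<psi> \<and> (\<forall>w\<in>UNIV. \<psi> (word sV w) = \<phi> (F w))"
    by (intro exI[of _ "\<lambda>t. t (\<lambda>w. \<phi> (F w))"] conjI linear_apply) (auto simp: word_def)
qed simp

lemma bilinear_tensor:
  assumes "vector_space sA" "vector_space sB"
  shows "bilinear_map sA sB fun_scale (tensor sA sB)"
  using assms vector_space_fun_scale
  by (auto simp: bilinear_map_def tensor_def Vector_Spaces.linear_iff fun_scale_def fun_eq_iff)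

lemma tensor_assoc_eq:
  fixes sA :: "'d::field \<Rightarrow> 'a::ab_group_add \<Rightarrow> 'a" and sB :: "'d \<Rightarrow> 'b::ab_group_add \<Rightarrow> 'b"
    and sC :: "'d \<Rightarrow> 'c::ab_group_add \<Rightarrow> 'c"
  assumes "vector_space sA" "vector_space sB" "vector_space sC"
  shows "tensor_assoc sA sB sC
      (lin_comb fun_scale (\<lambda>(x, y, z). tensor fun_scale sC (tensor sA sB x y) z) L) =
    lin_comb fun_scale (\<lambda>(x, y, z). tensor sA fun_scale x (tensor sB sC y z)) L"
  unfolding tensor_assoc_def
proof (rule linear_extension_eq[OF vector_space_fun_scale])
  fix \<phi> :: "('a, ('b, 'c, 'd) tensor, 'd) tensor \<Rightarrow> 'd"
  assume \<phi>: "Vector_Spaces.linear fun_scale (*) \<phi>"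
  define G where "G x y z = \<phi> (tensor sA fun_scale x (tensor sB sC y z))" for x y z
  have tBC: "bilinear_map sB sC fun_scale (tensor sB sC)"
    and tA: "bilinear_map sA fun_scale fun_scale
      (tensor sA (fun_scale :: 'd \<Rightarrow> ('b, 'c, 'd) tensor \<Rightarrow> _))"
    using assms bilinear_tensor vector_space_fun_scale by blast+
  have G: "bilinear_map sA sB (*) (\<lambda>x y. G x y z)" "Vector_Spaces.linear sC (*) (G x y)" for x y z
    using tBC tA \<phi> unfolding bilinear_map_def Vector_Spaces.linear_iff G_def by auto
  define E where "E u z = u (\<lambda>x y. G x y z)" for u :: "('a, 'b, 'd) tensor" and z
  have E: "E (tensor sA sB x y) z = G x y z" for x y z
    using G(1) by (simp add: E_def tensor_def)
  interpret amb: vector_space "fun_scale :: 'd \<Rightarrow> ('a, 'b, 'd) tensor \<Rightarrow> _"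
    by (rule vector_space_fun_scale)
  interpret pair: vector_space_pair "fun_scale :: 'd \<Rightarrow> ('a, 'b, 'd) tensor \<Rightarrow> _" fun_scale
    by (simp add: vector_space_pair_def vector_space_fun_scale)
  define T where "T = amb.span (range (\<lambda>(x, y). tensor sA sB x y))"
  obtain \<pi> where \<pi>: "\<And>u. \<pi> u \<in> T" "Vector_Spaces.linear fun_scale fun_scale \<pi>"
      "\<And>u. u \<in> T \<Longrightarrow> \<pi> u = u"
    using pair.linear_exists_left_inverse_on[OF amb.linear_ident, of T] by (auto simp: T_def)
  have Ez: "Vector_Spaces.linear sC (*) (E u)" if "u \<in> T" for u
    using that unfolding T_def
  proof (induction rule: amb.span_induct_alt)
    case base
    then show ?case using assms vector_space_field by (auto simp: E_def Vector_Spaces.linear_iff)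
  next
    case (step c x y)
    then obtain a b where x: "x = tensor sA sB a b" by auto
    have "E (fun_scale c x + y) = (\<lambda>z. c * G a b z + E y z)"
      using E[of a b] by (auto simp: x E_def fun_scale_def)
    then show ?case using step(2) G(2)[of a b] unfolding \<open>E _ = _\<close>
      by (auto simp: Vector_Spaces.linear_iff algebra_simps)
  qed
  have Eu: "Vector_Spaces.linear fun_scale (*) (\<lambda>u. E u z)" for z
    unfolding E_def by (rule linear_apply)
  have bil: "bilinear_map fun_scale sC (*) (\<lambda>u. E (\<pi> u))"
    using Ez \<pi>(1) linear_compose_functional[OF \<pi>(2) Eu] by (auto simp: bilinear_map_def)
  have "tensor sA sB x y \<in> T" for x y
    unfolding T_def by (rule amb.span_base) (auto intro: image_eqI[of _ _ "(x, y)"])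
  then have "tensor fun_scale sC (tensor sA sB x y) z (\<lambda>u. E (\<pi> u)) = G x y z" for x y z
    using bil by (simp add: tensor_def[of fun_scale] \<pi>(3) E)
  then show "\<exists>\<psi>. Vector_Spaces.linear fun_scale (*) \<psi> \<and>
      (\<forall>i\<in>UNIV. \<psi> (case i of (x, y, z) \<Rightarrow> tensor fun_scale sC (tensor sA sB x y) z) =
        \<phi> (case i of (x, y, z) \<Rightarrow> tensor sA fun_scale x (tensor sB sC y z)))"
    by (intro exI[of _ "\<lambda>t. t (\<lambda>u. E (\<pi> u))"] conjI linear_apply) (auto simp: G_def)
qed simp

context graded_vector_space
begin

definition component :: "nat \<Rightarrow> 'h \<Rightarrow> 'h" where
  "component n x =
     (THE c. (\<forall>n. c n \<in> H n) \<and> finite {n. c n \<noteq> 0} \<and> x = (\<Sum>n | c n \<noteq> 0. c n)) n"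

lemma component:
  "component n x \<in> H n" "finite {n. component n x \<noteq> 0}"
  "(\<Sum>n | component n x \<noteq> 0. component n x) = x"
  using theI'[OF direct_sum[of x]] unfolding component_def by auto

lemma component_eqI:
  assumes "\<And>n. c n \<in> H n" "finite A" "\<And>n. n \<notin> A \<Longrightarrow> c n = 0" "x = (\<Sum>n\<in>A. c n)"
  shows "component n x = c n"
proof -
  have fin: "finite {n. c n \<noteq> 0}" using assms(2,3) by (metis (mono_tags) finite_subset mem_Collect_eq subsetI)
  have "(\<Sum>n\<in>A. c n) = (\<Sum>n | c n \<noteq> 0. c n)"
    using assms(2,3) by (intro sum.mono_neutral_right) auto
  with assms fin have "(\<forall>n. c n \<in> H n) \<and> finite {n. c n \<noteq> 0} \<and> x = (\<Sum>n | c n \<noteq> 0. c n)" by simp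
  from the1_equality[OF direct_sum[of x], OF this] show ?thesis by (simp add: component_def)
qed

lemma component_sum: "finite A \<Longrightarrow> {n. component n x \<noteq> 0} \<subseteq> A \<Longrightarrow> (\<Sum>n\<in>A. component n x) = x"
  using component(3)[of x] by (subst sum.mono_neutral_right[of A "{n. component n x \<noteq> 0}"]) auto

lemma component_add: "component n (x + y) = component n x + component n y"
proof (rule component_eqI[of _ "{n. component n x \<noteq> 0} \<union> {n. component n y \<noteq> 0}"])
  let ?A = "{n. component n x \<noteq> 0} \<union> {n. component n y \<noteq> 0}"
  show "x + y = (\<Sum>n\<in>?A. component n x + component n y)"
    unfolding sum.distrib using component(2) by (subst (1 2) component_sum) auto
qed (use component subspace_component subspace_add in auto)

lemma component_scale: "component n (scale c x) = scale c (component n x)"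
proof (rule component_eqI[of _ "{n. component n x \<noteq> 0}"])
  show "scale c x = (\<Sum>n | component n x \<noteq> 0. scale c (component n x))"
    by (simp add: scale_sum_right[symmetric] component(3))
qed (use component subspace_component subspace_scale in auto)

lemma component_homogeneous: "x \<in> H m \<Longrightarrow> component n x = (if n = m then x else 0)"
  by (rule component_eqI[of _ "{m}"]) (use subspace_component subspace_0 in auto)

definition weight :: "'k \<Rightarrow> 'h \<Rightarrow> 'h" where
  "weight r x = (\<Sum>n | component n x \<noteq> 0. scale (r ^ n) (component n x))"

lemma weight_eq:
  "finite A \<Longrightarrow> {n. component n x \<noteq> 0} \<subseteq> A \<Longrightarrow> (\<Sum>n\<in>A. scale (r ^ n) (component n x)) = weight r x"
  unfolding weight_def by (rule sum.mono_neutral_right) auto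

lemma linear_weight: "Vector_Spaces.linear scale scale (weight r)"
proof -
  have "weight r (x + y) = weight r x + weight r y" for x y
  proof -
    let ?A = "{n. component n x \<noteq> 0} \<union> {n. component n y \<noteq> 0}"
    have A: "finite ?A" using component(2) by auto
    have "weight r (x + y) = (\<Sum>n\<in>?A. scale (r ^ n) (component n (x + y)))"
      using A by (intro weight_eq[symmetric]) (auto simp: component_add)
    also have "\<dots> = weight r x + weight r y"
      unfolding component_add scale_right_distrib sum.distrib using A
      by (subst (1 2) weight_eq) auto
    finally show ?thesis .
  qed
  moreover have "weight r (scale c x) = scale c (weight r x)" for c x
  proof -
    have "weight r (scale c x) = (\<Sum>n | component n x \<noteq> 0. scale (r ^ n) (component n (scale c x)))"
      using component(2) by (intro weight_eq[symmetric]) (auto simp: component_scale)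
    then show ?thesis
      by (simp add: weight_def component_scale scale_sum_right mult.commute)
  qed
  ultimately show ?thesis using vector_space_axioms by (auto simp: Vector_Spaces.linear_iff)
qed

lemma weight_homogeneous:
  assumes "x \<in> homogeneous H"
  shows "weight r x = scale (r ^ degree_of H x) x"
proof -
  have "x \<in> H (degree_of H x)"
    using assms unfolding homogeneous_def degree_of_def by (auto intro: LeastI)
  then show ?thesis by (auto simp: weight_def component_homogeneous Collect_conv_if)
qed

end

text \<open>On pure tensors of homogeneous elements, \<open>braided_mult\<close> is given by the intended formula.\<close>

lemma (in graded_algebra) braided_mult_eq:
  assumes L: "snd ` set L \<subseteq> homogeneous H \<times> homogeneous H"
    and L': "snd ` set L' \<subseteq> homogeneous H \<times> homogeneous H"
  shows "braided_mult scale H q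
      (lin_comb fun_scale (\<lambda>(x, y). tensor scale scale x y) L)
      (lin_comb fun_scale (\<lambda>(x, y). tensor scale scale x y) L') =
    lin_comb fun_scale (\<lambda>(x, y). lin_comb fun_scale (\<lambda>(x', y').
      fun_scale (q ^ (degree_of H y * degree_of H x')) (tensor scale scale (x * x') (y * y'))) L') L"
proof -
  define I where "I = homogeneous H \<times> homogeneous H"
  define e where "e = (\<lambda>(x, y). tensor scale scale x y)"
  define F where "F = (\<lambda>(x, y) (x', y').
      fun_scale (q ^ (degree_of H y * degree_of H x')) (tensor scale scale (x * x') (y * y')))"
  note lins = Vector_Spaces.linear_iff scale_mult_left scale_mult_right distrib_left distrib_right
  note tl = bilinear_tensor[OF vector_space_axioms vector_space_axioms]
  have ex: "\<exists>\<psi>. Vector_Spaces.linear fun_scale (*) \<psi> \<and> (\<forall>i\<in>I. \<psi> (e i) = \<phi> (f i))"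
    if \<phi>: "Vector_Spaces.linear fun_scale (*) \<phi>"
      and B: "bilinear_map scale scale fun_scale B" "\<And>x y. (x, y) \<in> I \<Longrightarrow> f (x, y) = B x y"
    for f :: "'h \<times> 'h \<Rightarrow> ('h, 'h, 'k) tensor" and \<phi> B
  proof (intro exI[of _ "\<lambda>t. t (\<lambda>x y. \<phi> (B x y))"] conjI linear_apply ballI)
    fix i assume "i \<in> I"
    have "bilinear_map scale scale (*) (\<lambda>x y. \<phi> (B x y))"
      using B(1) \<phi> by (auto simp: bilinear_map_def Vector_Spaces.linear_iff)
    with \<open>i \<in> I\<close> show "e i (\<lambda>x y. \<phi> (B x y)) = \<phi> (f i)"
      by (cases i) (auto simp: e_def tensor_def B(2))
  qed
  have inner: "linear_extension fun_scale fun_scale I e (F i) (lin_comb fun_scale e L') =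
      lin_comb fun_scale (F i) L'" for i
  proof (rule linear_extension_eq[OF vector_space_fun_scale])
    obtain x y where i: "i = (x, y)" by fastforce
    define B where "B x' y' = tensor scale scale (x * weight (q ^ degree_of H y) x') (y * y')" for x' y'
    have "bilinear_map scale scale fun_scale B"
      using tl linear_weight[of "q ^ degree_of H y"] unfolding bilinear_map_def B_def by (auto simp: lins)
    moreover have "F i (x', y') = B x' y'" if "(x', y') \<in> I" for x' y'
      using that tl by (auto simp: I_def F_def B_def i weight_homogeneous scale_mult_right power_mult
          bilinear_map_def Vector_Spaces.linear_iff)
    ultimately show "\<exists>\<psi>. Vector_Spaces.linear fun_scale (*) \<psi> \<and> (\<forall>j\<in>I. \<psi> (e j) = \<phi> (F i j))"
      if "Vector_Spaces.linear fun_scale (*) \<phi>" for \<phi> using ex[OF that] by blast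
  qed (use L' in \<open>simp add: I_def\<close>)
  have outer: "linear_extension fun_scale fun_scale I e (\<lambda>i. lin_comb fun_scale (F i) L') (lin_comb fun_scale e L) =
      lin_comb fun_scale (\<lambda>i. lin_comb fun_scale (F i) L') L"
  proof (rule linear_extension_eq[OF vector_space_fun_scale])
    define b where "b x y x' y' = tensor scale scale (x * x') (weight (q ^ degree_of H x') y * y')" for x y x' y'
    define B where "B x y = lin_comb fun_scale (\<lambda>(x', y'). b x y x' y') L'" for x y
    have b: "bilinear_map scale scale fun_scale (\<lambda>x y. b x y x' y')" for x' y'
      using tl linear_weight[of "q ^ degree_of H x'"] unfolding bilinear_map_def b_def by (auto simp: lins)
    have "bilinear_map scale scale fun_scale B"
      unfolding B_def
    proof (induction L')
      case Nil
      then show ?case using vector_space_axioms vector_space_fun_scale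
        by (simp add: bilinear_map_def Vector_Spaces.linear_iff lin_comb_def)
           (simp add: fun_scale_def fun_eq_iff)
    next
      case (Cons a L')
      obtain c x' y' where a: "a = (c, x', y')" by (cases a) auto
      show ?case using Cons b[of x' y']
        by (auto simp: a bilinear_map_def Vector_Spaces.linear_iff lin_comb_def fun_scale_apply fun_eq_iff algebra_simps)
    qed
    moreover have "lin_comb fun_scale (F (x, y)) L' = B x y" if "(x, y) \<in> I" for x y
      unfolding B_def
    proof (rule lin_comb_cong)
      fix i assume "i \<in> snd ` set L'"
      then have "i \<in> I" using L' by (auto simp: I_def)
      then show "F (x, y) i = (case i of (x', y') \<Rightarrow> b x y x' y')"
        using that tl by (auto simp: I_def F_def b_def weight_homogeneous scale_mult_left
          power_mult[symmetric] mult.commute[of "degree_of H y"] bilinear_map_def Vector_Spaces.linear_iff)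
    qed
    ultimately show "\<exists>\<psi>. Vector_Spaces.linear fun_scale (*) \<psi> \<and>
        (\<forall>j\<in>I. \<psi> (e j) = \<phi> (lin_comb fun_scale (F j) L'))"
      if "Vector_Spaces.linear fun_scale (*) \<phi>" for \<phi>
      using ex[OF that, of B "\<lambda>j. lin_comb fun_scale (F j) L'"] by blast
  qed (use L in \<open>simp add: I_def\<close>)
  have "linear_extension fun_scale fun_scale I e
      (\<lambda>i. linear_extension fun_scale fun_scale I e (F i) (lin_comb fun_scale e L')) (lin_comb fun_scale e L) =
      lin_comb fun_scale (\<lambda>i. lin_comb fun_scale (F i) L') L"
    unfolding inner by (rule outer)
  then show ?thesis
    by (simp add: braided_mult_def Let_def I_def e_def F_def case_prod_unfold)
qed

lemma multilinear_word:
  assumes "vector_space sV"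
  shows "multilinear_map sV fun_scale (word sV)"
  using assms vector_space_fun_scale
  by (auto simp: multilinear_map_def word_def Vector_Spaces.linear_iff fun_scale_def fun_eq_iff)

lemma linear_sum_maps:
  assumes "vector_space s" "vector_space s'" "finite A"
    and "\<And>i. i \<in> A \<Longrightarrow> Vector_Spaces.linear s s' (g i)"
  shows "Vector_Spaces.linear s s' (\<lambda>x. \<Sum>i\<in>A. g i x)"
proof -
  interpret s': vector_space s' by fact
  show ?thesis using assms
    by (auto simp: Vector_Spaces.linear_iff sum.distrib[symmetric] s'.scale_sum_right intro!: sum.cong)
qed

lemma deconcatenation_eq:
  assumes V: "vector_space sV"
  shows "deconcatenation sV (lin_comb fun_scale (word sV) L) =
    lin_comb fun_scale (\<lambda>w. \<Sum>i\<le>length w.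
      tensor fun_scale fun_scale (word sV (take i w)) (word sV (drop i w))) L"
  unfolding deconcatenation_def
proof (rule word_extension_eq[OF vector_space_fun_scale], unfold multilinear_map_def, intro allI)
  fix us ws
  have t: "bilinear_map fun_scale fun_scale fun_scale (tensor (fun_scale :: 'a \<Rightarrow> ('b, 'a) word_tensor \<Rightarrow> _)
      (fun_scale :: 'a \<Rightarrow> ('b, 'a) word_tensor \<Rightarrow> _))"
    by (intro bilinear_tensor vector_space_fun_scale)
  have "Vector_Spaces.linear sV fun_scale (\<lambda>x. tensor fun_scale fun_scale
      (word sV (take i (us @ x # ws))) (word sV (drop i (us @ x # ws))))" for i
  proof (cases "i \<le> length us")
    case True
    have "Vector_Spaces.linear sV fun_scale (\<lambda>x. word sV (drop i us @ x # ws))"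
      using multilinear_word[OF V] by (auto simp: multilinear_map_def)
    with True show ?thesis
      using t unfolding bilinear_map_def
      by (auto intro: linear_compose_functional[where g = "tensor fun_scale fun_scale (word sV (take i us))"])
  next
    case False
    then obtain j where i: "i = length us + Suc j"
      using less_imp_Suc_add[of "length us" i] by auto
    have "Vector_Spaces.linear sV fun_scale (\<lambda>x. word sV (us @ x # take j ws))"
      using multilinear_word[OF V] by (auto simp: multilinear_map_def)
    with i show ?thesis
      using t unfolding bilinear_map_def
      by (auto intro: linear_compose_functional[where g = "\<lambda>u. tensor fun_scale fun_scale u (word sV (drop j ws))"])
  qed
  then show "Vector_Spaces.linear sV fun_scale (\<lambda>x. \<Sum>i\<le>length (us @ x # ws). tensor fun_scale fun_scale
      (word sV (take i (us @ x # ws))) (word sV (drop i (us @ x # ws))))"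
    using linear_sum_maps[OF V vector_space_fun_scale, of "{..length us + Suc (length ws)}"
        "\<lambda>i x. tensor fun_scale fun_scale (word sV (take i (us @ x # ws))) (word sV (drop i (us @ x # ws)))"]
    by simp
qed

lemma word_counit_eq:
  assumes "vector_space sV"
  shows "word_counit sV (lin_comb fun_scale (word sV) L) = lin_comb (*) (\<lambda>w. if w = [] then 1 else 0) L"
  unfolding word_counit_def
  by (rule word_extension_eq[OF vector_space_field])
     (use assms vector_space_field in \<open>auto simp: multilinear_map_def Vector_Spaces.linear_iff\<close>)

end

theory Submission
  imports Defs
begin

text \<open>
  Identify \<open>H\<close> with the deconcatenation coalgebra on \<open>V\<close> and choose a homogeneous basis of \<open>V\<close>.
  The words \<open>w\<close> in its letters give a basis \<open>e w\<close> of \<open>H\<close> with \<open>\<Delta> (e w) = \<Sum> e u \<otimes> e v\<close> over the cuts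
  \<open>w = u @ v\<close>; let \<open>\<xi> w\<close> be the dual coordinates.  The multiplication of \<open>H\<close> is unknown, so \<open>S\<close>
  cannot be computed outright, but the trace on \<open>H m\<close> needs only the diagonal coordinates
  \<open>\<xi> w (S (e w))\<close> for the words \<open>w\<close> of weight \<open>m\<close> (\<open>subspace_trace_dual\<close>).

  These are accessible because \<open>S\<close> is an anti-morphism of coalgebras for the \<open>q\<close>-braiding
  (\<open>comult_antipode\<close>):
  \<open>\<Delta> (S (e w)) = \<Sum> q\<^bsup>|u||v|\<^esup> S (e v) \<otimes> S (e u)\<close> over the cuts \<open>w = u @ v\<close>, where \<open>|u|\<close> is the
  weight of \<open>u\<close>, that is, the sum of the degrees of its letters.
  Both sides are right convolution inverses of \<open>\<Delta>\<close> with values in the braided algebra \<open>H \<otimes> H\<close>.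
  Since the term of the convolution with an empty left part is the value at \<open>w\<close> itself and all
  other terms involve shorter words, such an inverse is unique by induction on the length of \<open>w\<close>.

  Dually, concatenation of words is the convolution of coordinates:
  \<open>\<xi> (a # u) = (\<xi> [a] \<otimes> \<xi> u) \<circ> \<Delta>\<close>.  Letters are primitive, hence \<open>S (e [a]) = - e [a]\<close>, and \<open>S\<close> fixes
  the unit.  Reading off one letter after the other shows that on the words of length \<open>k\<close> the
  antipode is, up to words of smaller length, \<open>(-1)\<^bsup>k\<^esup> q\<^bsup>inv\<^esup>\<close> times the reversal of words
  (\<open>coordinate_antipode\<close>).  So exactly the palindromes contribute to the trace, each with
  \<open>(-1)\<^bsup>k\<^esup> q\<^bsup>inv\<^esup>\<close>.

  It remains to count palindromes by their sequence of letter weights (\<open>card_palindromes\<close>), and to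
  see that the letters of weight \<open>n\<close> are as many as the dimension of the primitive elements of
  degree \<open>n\<close> (\<open>dim_primitives\<close>).
\<close>

section \<open>Dual families and traces\<close>

context vector_space
begin

lemma functional_zero_on_span:
  assumes "Vector_Spaces.linear scale (*) \<phi>" "\<And>x. x \<in> B \<Longrightarrow> \<phi> x = 0" "x \<in> span B"
  shows "\<phi> x = 0"
proof -
  interpret \<phi>: Vector_Spaces.linear scale "(*)" \<phi> by fact
  show ?thesis
    using assms(3) by (induction rule: span_induct_alt) (auto simp: assms(2) \<phi>.zero \<phi>.add \<phi>.scale)
qed

lemma functional_sum:
  assumes "Vector_Spaces.linear scale (*) \<phi>"
  shows "\<phi> (\<Sum>j\<in>J. scale (c j) (g j)) = (\<Sum>j\<in>J. c j * \<phi> (g j))"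
proof -
  interpret \<phi>: Vector_Spaces.linear scale "(*)" \<phi> by fact
  show ?thesis by (simp add: \<phi>.sum \<phi>.scale)
qed

context
  fixes I :: "'i set" and e :: "'i \<Rightarrow> 'b" and \<xi> :: "'i \<Rightarrow> 'b \<Rightarrow> 'a"
  assumes linear_\<xi>: "\<And>i. i \<in> I \<Longrightarrow> Vector_Spaces.linear scale (*) (\<xi> i)"
    and dual: "\<And>i j. i \<in> I \<Longrightarrow> j \<in> I \<Longrightarrow> \<xi> i (e j) = (if i = j then 1 else 0)"
begin

lemma inj_on_if_dual: "inj_on e I"
  by (rule inj_onI) (metis dual zero_neq_one)

lemma independent_if_dual: "independent (e ` I)"
proof
  assume "dependent (e ` I)"
  then obtain i where i: "i \<in> I" "e i \<in> span (e ` I - {e i})"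
    unfolding dependent_def by blast
  have "\<xi> i (e i) = 0"
    using linear_\<xi>[OF i(1)] _ i(2)
    by (rule functional_zero_on_span) (use dual i(1) in \<open>metis (no_types, lifting) DiffE imageE insertI1\<close>)
  with dual i(1) show False by simp
qed

lemma finite_if_dual:
  assumes "finite C" "e ` I \<subseteq> span C"
  shows "finite I"
  using independent_span_bound[OF assms(1) independent_if_dual assms(2)] finite_imageD[OF _ inj_on_if_dual]
  by blast

lemma dim_span_if_dual: "dim (span (e ` I)) = card I"
  by (simp add: dim_eq_card_independent[OF independent_if_dual] card_image[OF inj_on_if_dual])

lemma dual_expansion:
  assumes "finite I" "x \<in> span (e ` I)"
  shows "(\<Sum>i\<in>I. scale (\<xi> i x) (e i)) = x"
  using assms(2)
proof (induction rule: span_induct_alt)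
  case base
  have "\<xi> i 0 = 0" if "i \<in> I" for i
    using functional_zero_on_span[OF linear_\<xi>[OF that], of "{}" 0] by simp
  then show ?case by simp
next
  case (step c x y)
  then obtain j where j: "j \<in> I" "x = e j" by blast
  have "(\<Sum>i\<in>I. scale (\<xi> i (scale c x + y)) (e i)) =
      (\<Sum>i\<in>I. scale (if i = j then c else 0) (e i)) + (\<Sum>i\<in>I. scale (\<xi> i y) (e i))"
    unfolding sum.distrib[symmetric] using linear_\<xi> dual j
    by (intro sum.cong) (auto simp: Vector_Spaces.linear_iff scale_left_distrib)
  also have "(\<Sum>i\<in>I. scale (if i = j then c else 0) (e i)) = (\<Sum>i\<in>I. if i = j then scale c (e j) else 0)"
    by (intro sum.cong) auto
  finally show ?case using assms(1) j step(2) by simp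
qed

text \<open>
  The trace is computed in an unspecified basis \<open>B\<close>; expanding \<open>B\<close> in the family \<open>e\<close> and
  interchanging the two summations moves it to the family \<open>e\<close>.
\<close>

lemma subspace_trace_dual:
  assumes "finite I" and U: "U = span (e ` I)"
    and S: "Vector_Spaces.linear scale scale S" "S ` U \<subseteq> U"
  shows "subspace_trace scale U S = (\<Sum>i\<in>I. \<xi> i (S (e i)))"
proof -
  define B where "B = (SOME B. independent B \<and> span B = U)"
  have B: "independent B" "span B = U"
    using someI[of "\<lambda>B. independent B \<and> span B = U" "e ` I"] independent_if_dual U by (auto simp: B_def)
  have finB: "finite B"
    using independent_span_bound[OF finite_imageI[OF assms(1)] B(1)] B(2) U span_superset by blast
  interpret S: Vector_Spaces.linear scale scale S by fact
  have mem: "S (e i) \<in> U" if "i \<in> I" for i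
    using that S(2) U span_superset by blast
  have "subspace_trace scale U S = (\<Sum>b\<in>B. representation B (S b) b)"
    by (simp add: subspace_trace_def B_def Let_def)
  also have "\<dots> = (\<Sum>b\<in>B. \<Sum>i\<in>I. \<xi> i b * representation B (S (e i)) b)"
  proof (rule sum.cong[OF refl])
    fix b assume "b \<in> B"
    then have "b \<in> span (e ` I)" using B(2) U span_superset by blast
    from dual_expansion[OF assms(1) this] have "S b = (\<Sum>i\<in>I. scale (\<xi> i b) (S (e i)))"
      by (metis (mono_tags, lifting) S.scale S.sum sum.cong)
    then have "representation B (S b) = (\<lambda>b'. \<Sum>i\<in>I. representation B (scale (\<xi> i b) (S (e i))) b')"
      using representation_sum[OF B(1), of I "\<lambda>i. scale (\<xi> i b) (S (e i))"] mem span_scale B(2) by auto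
    then show "representation B (S b) b = (\<Sum>i\<in>I. \<xi> i b * representation B (S (e i)) b)"
      using representation_scale[OF B(1)] mem B(2) by simp
  qed
  also have "\<dots> = (\<Sum>i\<in>I. \<Sum>b\<in>B. representation B (S (e i)) b * \<xi> i b)"
    by (subst sum.swap) (simp add: mult.commute)
  also have "\<dots> = (\<Sum>i\<in>I. \<xi> i (S (e i)))"
  proof (rule sum.cong[OF refl])
    fix i assume i: "i \<in> I"
    have "(\<Sum>b\<in>B. scale (representation B (S (e i)) b) b) = S (e i)"
      using sum_representation_eq[OF B(1) _ finB subset_refl] mem[OF i] B(2) by blast
    with functional_sum[OF linear_\<xi>[OF i], of "representation B (S (e i))" "\<lambda>b. b" B]
    show "(\<Sum>b\<in>B. representation B (S (e i)) b * \<xi> i b) = \<xi> i (S (e i))" by simp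
  qed
  finally show ?thesis .
qed

end

end

section \<open>Cutting a list in two\<close>

text \<open>
  Deconcatenation is a sum over \<open>splits w\<close>.  In this form coassociativity
  (\<open>sum_splits_assoc\<close>) is an identity between sums of arbitrary functions of three lists, so that
  triple tensors never occur.
\<close>

definition splits :: "'a list \<Rightarrow> ('a list \<times> 'a list) set" where
  "splits w = {(u, v). u @ v = w}"

lemma splits_Nil [simp]: "splits [] = {([], [])}"
  by (auto simp: splits_def)

lemma splits_Cons: "splits (x # w) = insert ([], x # w) ((\<lambda>(u, v). (x # u, v)) ` splits w)"
  by (auto simp: splits_def append_eq_Cons_conv image_iff)

lemma finite_splits [simp]: "finite (splits w)"
  by (induction w) (auto simp: splits_Cons)

lemma sum_splits_Cons:
  "(\<Sum>(u, v)\<in>splits (x # w). F u v) = F [] (x # w) + (\<Sum>(u, v)\<in>splits w. F (x # u) v)"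
proof -
  have "inj_on (\<lambda>(u, v). (x # u, v)) (splits w)" by (auto simp: inj_on_def)
  then show ?thesis
    unfolding splits_Cons by (subst sum.insert) (auto simp: sum.reindex case_prod_unfold)
qed

lemma sum_take_drop: "(\<Sum>i\<le>length w. F (take i w) (drop i w)) = (\<Sum>(u, v)\<in>splits w. F u v)"
proof (induction w arbitrary: F)
  case (Cons x w)
  show ?case
    using Cons[of "\<lambda>u. F (x # u)"]
    by (simp add: sum.atMost_Suc_shift sum_splits_Cons del: sum.atMost_Suc)
qed simp

lemma sum_splits_assoc:
  "(\<Sum>(u, c)\<in>splits w. \<Sum>(a, b)\<in>splits u. F a b c) = (\<Sum>(a, v)\<in>splits w. \<Sum>(b, c)\<in>splits v. F a b c)"
proof (induction w arbitrary: F)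
  case (Cons x w)
  show ?case
    using Cons[of "\<lambda>a. F (x # a)"]
    by (simp only: sum_splits_Cons splits_Nil) (simp add: case_prod_unfold sum.distrib add.assoc)
qed simp

section \<open>Tensors written as finite sums\<close>

lemma lin_comb_map_distinct:
  "distinct xs \<Longrightarrow> lin_comb s e (map (\<lambda>i. (c i, h i)) xs) = (\<Sum>i\<in>set xs. s (c i) (e (h i)))"
  by (simp add: lin_comb_def sum_list_distinct_conv_sum_set comp_def)

lemma fun_scale_one [simp]: "fun_scale 1 t = t"
  by (simp add: fun_scale_def)

lemma fun_scale_zero [simp]: "fun_scale c 0 = 0" "fun_scale 0 t = 0"
  by (simp_all add: fun_scale_def fun_eq_iff)

lemma fun_scale_sum:
  fixes t :: "'i \<Rightarrow> 'c \<Rightarrow> 'a::field"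
  shows "fun_scale c (\<Sum>i\<in>I. t i) = (\<Sum>i\<in>I. fun_scale c (t i))"
proof -
  interpret vector_space "fun_scale :: 'a \<Rightarrow> ('c \<Rightarrow> 'a) \<Rightarrow> _" by (rule vector_space_fun_scale)
  show ?thesis by (rule scale_sum_right)
qed

lemma fun_scale_scale: "fun_scale b (fun_scale c t) = fun_scale (b * c) t"
  by (simp add: fun_scale_def mult.assoc)

lemma tensor_lift_sum:
  assumes "finite I" "bilinear_map sA sB sU F"
  shows "tensor_lift sA sB sU F (\<Sum>i\<in>I. tensor sA sB (x i) (y i)) = (\<Sum>i\<in>I. F (x i) (y i))"
proof -
  obtain xs where xs: "distinct xs" "set xs = I"
    using finite_distinct_list[OF assms(1)] by blast
  interpret U: vector_space sU using assms(2) by (auto simp: bilinear_map_def Vector_Spaces.linear_iff)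
  show ?thesis
    using tensor_lift_eq[OF assms(2), of "map (\<lambda>i. (1, x i, y i)) xs"]
    by (simp add: lin_comb_map_distinct xs)
qed

lemma tensor_map_sum:
  assumes "finite I" "Vector_Spaces.linear sA sC f" "Vector_Spaces.linear sB sD g"
  shows "tensor_map sA sB sC sD f g (\<Sum>i\<in>I. tensor sA sB (x i) (y i)) = (\<Sum>i\<in>I. tensor sC sD (f (x i)) (g (y i)))"
  unfolding tensor_map_def
proof (rule tensor_lift_sum[OF assms(1)])
  have "bilinear_map sC sD fun_scale (tensor sC sD)"
    using assms by (intro bilinear_tensor) (auto simp: Vector_Spaces.linear_iff)
  then show "bilinear_map sA sB fun_scale (\<lambda>x y. tensor sC sD (f x) (g y))"
    using assms unfolding bilinear_map_def
    by (auto simp: Vector_Spaces.linear_iff)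
qed

lemma tensor_apply: "bilinear_map sA sB (*) F \<Longrightarrow> tensor sA sB x y F = F x y"
  by (simp add: tensor_def)

context vector_space
begin

lemma linear_tensor_left: "Vector_Spaces.linear scale fun_scale (\<lambda>x. tensor scale scale x y)"
  and linear_tensor_right: "Vector_Spaces.linear scale fun_scale (tensor scale scale x)"
  using bilinear_tensor[OF vector_space_axioms vector_space_axioms] by (auto simp: bilinear_map_def)

lemma tensor_sum_left: "tensor scale scale (\<Sum>i\<in>I. g i) y = (\<Sum>i\<in>I. tensor scale scale (g i) y)"
  by (rule module_hom.sum[OF Vector_Spaces.linear.axioms(3)[OF linear_tensor_left]])

lemma tensor_sum_right: "tensor scale scale x (\<Sum>i\<in>I. g i) = (\<Sum>i\<in>I. tensor scale scale x (g i))"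
  by (rule module_hom.sum[OF Vector_Spaces.linear.axioms(3)[OF linear_tensor_right]])

lemma tensor_zero: "tensor scale scale 0 y = 0" "tensor scale scale x 0 = 0"
  using tensor_sum_left[of _ "{}"] tensor_sum_right[of _ _ "{}"] by simp_all

end

lemma (in graded_vector_space) degree_of_eq:
  assumes "x \<in> H n" "x \<noteq> 0"
  shows "degree_of H x = n"
proof -
  have "x \<in> H (degree_of H x)" unfolding degree_of_def using assms(1) by (rule LeastI)
  from component_homogeneous[OF this, of n] component_homogeneous[OF assms(1), of n] assms(2)
  show ?thesis by (auto split: if_splits)
qed

text \<open>
  The exponents are stated with prescribed degrees \<open>m i\<close>, \<open>n j\<close> rather than with \<open>degree_of\<close>: the
  two may differ for a zero factor, but then the tensor vanishes.
\<close>

lemma (in graded_algebra) braided_mult_sum: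
  assumes fin: "finite I" "finite J"
    and I: "\<And>i. i \<in> I \<Longrightarrow> x i \<in> homogeneous H" "\<And>i. i \<in> I \<Longrightarrow> y i \<in> H (m i)"
    and J: "\<And>j. j \<in> J \<Longrightarrow> x' j \<in> H (n j)" "\<And>j. j \<in> J \<Longrightarrow> y' j \<in> homogeneous H"
  shows "braided_mult scale H q (\<Sum>i\<in>I. tensor scale scale (x i) (y i))
      (\<Sum>j\<in>J. fun_scale (c j) (tensor scale scale (x' j) (y' j))) =
    (\<Sum>i\<in>I. \<Sum>j\<in>J. fun_scale (c j * q ^ (m i * n j)) (tensor scale scale (x i * x' j) (y i * y' j)))"
proof -
  obtain xs ys where xs: "distinct xs" "set xs = I" and ys: "distinct ys" "set ys = J"
    using finite_distinct_list[OF fin(1)] finite_distinct_list[OF fin(2)] by blast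
  have deg: "fun_scale (q ^ (degree_of H (y i) * degree_of H (x' j))) (tensor scale scale (x i * x' j) (y i * y' j)) =
      fun_scale (q ^ (m i * n j)) (tensor scale scale (x i * x' j) (y i * y' j))" if "i \<in> I" "j \<in> J" for i j
    using that degree_of_eq[OF I(2)] degree_of_eq[OF J(1)]
    by (cases "y i = 0 \<or> x' j = 0") (auto simp: tensor_zero)
  have "braided_mult scale H q (\<Sum>i\<in>I. tensor scale scale (x i) (y i))
      (\<Sum>j\<in>J. fun_scale (c j) (tensor scale scale (x' j) (y' j))) =
    (\<Sum>i\<in>I. \<Sum>j\<in>J. fun_scale (c j) (fun_scale (q ^ (degree_of H (y i) * degree_of H (x' j)))
      (tensor scale scale (x i * x' j) (y i * y' j))))"
    using braided_mult_eq[of "map (\<lambda>i. (1, x i, y i)) xs" "map (\<lambda>j. (c j, x' j, y' j)) ys" q]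
      I J xs ys by (auto simp: lin_comb_map_distinct image_subset_iff homogeneous_def)
  also have "\<dots> = (\<Sum>i\<in>I. \<Sum>j\<in>J. fun_scale (c j * q ^ (m i * n j))
      (tensor scale scale (x i * x' j) (y i * y' j)))"
    by (intro sum.cong refl) (simp add: deg fun_scale_scale)
  finally show ?thesis .
qed

section \<open>The antipode reverses the coproduct\<close>

lemma sum_splits_empty_left: "(\<Sum>(u, v)\<in>splits w. if u = [] then F v else 0) = F w"
  by (cases w) (auto simp: sum_splits_Cons intro!: sum.neutral)

text \<open>
  A \<open>q\<close>-Hopf algebra with a basis of words, in coordinates: \<open>A\<close> is the alphabet, \<open>d\<close> the weight of a
  letter, \<open>e w\<close> the basis element of the word \<open>w\<close>, and \<open>\<xi> w\<close> the coordinate at \<open>w\<close>.  The values of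
  \<open>e\<close> and \<open>\<xi>\<close> outside \<open>lists A\<close> are arbitrary.
\<close>

locale cofree_q_hopf_algebra = q_hopf_algebra scale H \<Delta> \<epsilon> q S
  for scale :: "'k::field \<Rightarrow> 'h::ring_1 \<Rightarrow> 'h" and H and \<Delta> :: "'h \<Rightarrow> ('h, 'h, 'k) tensor"
    and \<epsilon> :: "'h \<Rightarrow> 'k" and q S +
  fixes A :: "'a set" and d :: "'a \<Rightarrow> nat" and e :: "'a list \<Rightarrow> 'h" and \<xi> :: "'a list \<Rightarrow> 'h \<Rightarrow> 'k"
  assumes connected: "dim (H 0) = 1"
    and finite_dimensional: "\<exists>B. finite B \<and> span B = H n"
    and component_words: "H n = span (e ` {w \<in> lists A. sum_list (map d w) = n})"
    and comult_word: "w \<in> lists A \<Longrightarrow> \<Delta> (e w) = (\<Sum>(u, v)\<in>splits w. tensor scale scale (e u) (e v))"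
    and counit_word: "w \<in> lists A \<Longrightarrow> \<epsilon> (e w) = (if w = [] then 1 else 0)"
    and linear_coordinate: "w \<in> lists A \<Longrightarrow> Vector_Spaces.linear scale (*) (\<xi> w)"
    and coordinate_word: "u \<in> lists A \<Longrightarrow> w \<in> lists A \<Longrightarrow> \<xi> u (e w) = (if u = w then 1 else 0)"
begin

abbreviation pure :: "'h \<Rightarrow> 'h \<Rightarrow> ('h, 'h, 'k) tensor" (infix "\<otimes>" 75) where
  "x \<otimes> y \<equiv> tensor scale scale x y"

definition weight_of :: "'a list \<Rightarrow> nat" where
  "weight_of w = sum_list (map d w)"

definition words :: "nat \<Rightarrow> 'a list set" where
  "words n = {w \<in> lists A. weight_of w = n}"

lemma weight_of_simps [simp]:
  "weight_of [] = 0" "weight_of (a # w) = d a + weight_of w" "weight_of (u @ v) = weight_of u + weight_of v"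
  by (simp_all add: weight_of_def)

lemma component_span: "H n = span (e ` words n)"
  by (simp add: component_words words_def weight_of_def)

lemma word_homogeneous: "w \<in> lists A \<Longrightarrow> e w \<in> H (weight_of w)"
  unfolding component_span by (intro span_base imageI) (simp add: words_def)

lemma splits_lists: "(u, v) \<in> splits w \<Longrightarrow> w \<in> lists A \<Longrightarrow> u \<in> lists A \<and> v \<in> lists A"
  by (auto simp: splits_def)

lemma
  assumes "\<And>w. w \<in> I \<Longrightarrow> w \<in> lists A"
  shows finite_if_words_bounded: "e ` I \<subseteq> H n \<Longrightarrow> finite I"
    and dim_span_words: "dim (span (e ` I)) = card I"
    and word_expansion: "finite I \<Longrightarrow> x \<in> span (e ` I) \<Longrightarrow> (\<Sum>w\<in>I. scale (\<xi> w x) (e w)) = x"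
proof -
  have lin: "Vector_Spaces.linear scale (*) (\<xi> w)" if "w \<in> I" for w
    using that assms linear_coordinate by blast
  have dual: "\<xi> u (e w) = (if u = w then 1 else 0)" if "u \<in> I" "w \<in> I" for u w
    using that assms coordinate_word by blast
  show "dim (span (e ` I)) = card I" by (rule dim_span_if_dual[OF lin dual])
  show "(\<Sum>w\<in>I. scale (\<xi> w x) (e w)) = x" if "finite I" "x \<in> span (e ` I)"
    by (rule dual_expansion[OF lin dual that])
  show "finite I" if "e ` I \<subseteq> H n"
  proof -
    obtain C where "finite C" "span C = H n" using finite_dimensional by blast
    with that show ?thesis using finite_if_dual[OF lin dual, where C = C] by auto
  qed
qed

lemma finite_words: "finite (words n)"
proof (rule finite_if_words_bounded[of _ n])
  show "e ` words n \<subseteq> H n" unfolding component_span by (rule span_superset)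
qed (simp add: words_def)

lemma trace_antipode: "subspace_trace scale (H n) S = (\<Sum>w\<in>words n. \<xi> w (S (e w)))"
  using antipode_degree linear_coordinate coordinate_word
  by (intro subspace_trace_dual finite_words component_span linear_antipode) (auto simp: words_def)

text \<open>Connectedness: \<open>H 0\<close> is one-dimensional and already contains the empty word.\<close>

lemma words_0: "words 0 = {[]}"
proof -
  have "card (words 0) = 1"
    using connected dim_span_words[of "words 0"] by (simp add: component_span words_def)
  moreover have "[] \<in> words 0" by (simp add: words_def)
  ultimately show ?thesis by (metis card_1_singletonE singletonD)
qed

lemma letter_weight_pos: "a \<in> A \<Longrightarrow> d a > 0"
  using words_0 by (force simp: words_def weight_of_def)

text \<open>\<open>H 0\<close> is spanned by \<open>e []\<close>, and the counit fixes the factor.\<close>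

lemma word_Nil: "e [] = 1"
proof -
  have "1 \<in> span {e []}" using one_degree by (simp add: component_span words_0)
  then obtain c where c: "1 = scale c (e [])" by (auto simp: span_singleton)
  interpret \<epsilon>: Vector_Spaces.linear scale "(*)" \<epsilon> by (rule linear_counit)
  have "\<epsilon> 1 = c" by (subst c) (simp add: \<epsilon>.scale counit_word)
  with c counit_one show ?thesis by simp
qed

lemma antipode_word:
  assumes "w \<in> lists A"
  shows "(\<Sum>(u, v)\<in>splits w. e u * S (e v)) = (if w = [] then 1 else 0)"
proof -
  have "bilinear_map scale scale scale (*)"
    unfolding bilinear_map_def Vector_Spaces.linear_iff
    by (auto simp: vector_space_axioms scale_mult_left scale_mult_right distrib_left distrib_right)
  then have "convolution scale \<Delta> id S (e w) = (\<Sum>(u, v)\<in>splits w. e u * S (e v))"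
    using linear_antipode
    by (simp add: convolution_def comult_word[OF assms] case_prod_unfold tensor_map_sum linear_id tensor_lift_sum)
  then show ?thesis using antipode_right[of "e w"] counit_word[OF assms] by (cases "w = []") auto
qed

lemma antipode_one: "S 1 = 1"
  using antipode_word[of "[]"] by (simp add: word_Nil)

lemma antipode_letter: "a \<in> A \<Longrightarrow> S (e [a]) = - e [a]"
  using antipode_word[of "[a]"] by (simp add: word_Nil antipode_one sum_splits_Cons eq_neg_iff_add_eq_0)

text \<open>\<open>(S \<otimes> S) \<circ> \<beta> \<circ> \<Delta>\<close> at \<open>e w\<close>, where \<open>\<beta>\<close> is the \<open>q\<close>-braiding.\<close>

definition flipped_comult :: "'a list \<Rightarrow> ('h, 'h, 'k) tensor" where
  "flipped_comult w =
     (\<Sum>(u, v)\<in>splits w. fun_scale (q ^ (weight_of u * weight_of v)) (S (e v) \<otimes> S (e u)))"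

lemma braided_mult_flipped_comult:
  assumes "u \<in> lists A" "v \<in> lists A"
  shows "braided_mult scale H q (\<Delta> (e u)) (flipped_comult v) =
    (\<Sum>(a, b)\<in>splits u. \<Sum>(x, y)\<in>splits v.
      fun_scale (q ^ (weight_of (b @ x) * weight_of y)) ((e a * S (e y)) \<otimes> (e b * S (e x))))"
proof -
  have deg: "e w \<in> H (weight_of w)" "S (e w) \<in> H (weight_of w)" if "w \<in> lists A" for w
    using that word_homogeneous antipode_degree by blast+
  have "braided_mult scale H q (\<Delta> (e u)) (flipped_comult v) =
      (\<Sum>p\<in>splits u. \<Sum>r\<in>splits v. fun_scale
        (q ^ (weight_of (fst r) * weight_of (snd r)) * q ^ (weight_of (snd p) * weight_of (snd r)))
        ((e (fst p) * S (e (snd r))) \<otimes> (e (snd p) * S (e (fst r)))))"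
    unfolding comult_word[OF assms(1)] flipped_comult_def case_prod_unfold
  proof (rule braided_mult_sum)
    fix p assume "p \<in> splits u"
    then have "fst p \<in> lists A" "snd p \<in> lists A"
      using splits_lists[of "fst p" "snd p" u] assms by simp_all
    then show "e (fst p) \<in> homogeneous H" "e (snd p) \<in> H (weight_of (snd p))"
      using deg unfolding homogeneous_def by blast+
  next
    fix p assume "p \<in> splits v"
    then have "fst p \<in> lists A" "snd p \<in> lists A"
      using splits_lists[of "fst p" "snd p" v] assms by simp_all
    then show "S (e (snd p)) \<in> H (weight_of (snd p))" "S (e (fst p)) \<in> homogeneous H"
      using deg unfolding homogeneous_def by blast+
  qed simp_all
  then show ?thesis
    by (simp add: case_prod_unfold power_add[symmetric] distrib_right add.commute)
qed

text \<open>
  \<open>flipped_comult\<close> is a right convolution inverse of \<open>\<Delta>\<close>.  For the cuts \<open>w = a @ b @ x @ y\<close> the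
  braided product contributes \<open>q\<^bsup>(|b|+|x|)|y|\<^esup> e a S(e y) \<otimes> e b S(e x)\<close>.  The exponent depends on \<open>b\<close> and
  \<open>x\<close> only through \<open>b @ x\<close>, so the sum over the cuts of \<open>t = b @ x\<close> is an instance of
  \<open>id * S = \<eta>\<epsilon>\<close> and forces \<open>t = []\<close>, where the power of \<open>q\<close> is \<open>q\<^sup>0 = 1\<close>; then the sum over the cuts
  \<open>a @ y\<close> is another instance.
\<close>

lemma convolution_flipped_comult:
  assumes "w \<in> lists A"
  shows "(\<Sum>(u, v)\<in>splits w. braided_mult scale H q (\<Delta> (e u)) (flipped_comult v)) =
    (if w = [] then 1 \<otimes> 1 else 0)"
proof -
  define G where "G a b x y =
    fun_scale (q ^ (weight_of (b @ x) * weight_of y)) ((e a * S (e y)) \<otimes> (e b * S (e x)))" for a b x y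
  have inner: "(\<Sum>(b, x)\<in>splits t. G a b x y) = (if t = [] then (e a * S (e y)) \<otimes> 1 else 0)"
    if "t \<in> lists A" for a t y
  proof -
    have "(\<Sum>(b, x)\<in>splits t. G a b x y) =
        (\<Sum>(b, x)\<in>splits t. fun_scale (q ^ (weight_of t * weight_of y)) ((e a * S (e y)) \<otimes> (e b * S (e x))))"
      by (intro sum.cong) (auto simp: G_def splits_def)
    also have "\<dots> = fun_scale (q ^ (weight_of t * weight_of y))
        ((e a * S (e y)) \<otimes> (\<Sum>(b, x)\<in>splits t. e b * S (e x)))"
      by (simp add: case_prod_unfold fun_scale_sum tensor_sum_right)
    finally show ?thesis by (simp add: antipode_word[OF that] tensor_zero)
  qed
  have "(\<Sum>(u, v)\<in>splits w. braided_mult scale H q (\<Delta> (e u)) (flipped_comult v)) =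
      (\<Sum>(u, v)\<in>splits w. \<Sum>(a, b)\<in>splits u. \<Sum>(x, y)\<in>splits v. G a b x y)"
  proof (intro sum.cong refl, clarify)
    fix u v assume "(u, v) \<in> splits w"
    then have "u \<in> lists A" "v \<in> lists A" using splits_lists assms by blast+
    then show "braided_mult scale H q (\<Delta> (e u)) (flipped_comult v) =
        (\<Sum>(a, b)\<in>splits u. \<Sum>(x, y)\<in>splits v. G a b x y)"
      unfolding G_def by (rule braided_mult_flipped_comult)
  qed
  also have "\<dots> = (\<Sum>(a, z)\<in>splits w. \<Sum>(b, v)\<in>splits z. \<Sum>(x, y)\<in>splits v. G a b x y)"
    by (rule sum_splits_assoc)
  also have "\<dots> = (\<Sum>(a, z)\<in>splits w. \<Sum>(t, y)\<in>splits z. \<Sum>(b, x)\<in>splits t. G a b x y)"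
    by (intro sum.cong refl, clarify) (rule sum_splits_assoc[symmetric])
  also have "\<dots> = (\<Sum>(a, z)\<in>splits w. \<Sum>(t, y)\<in>splits z. if t = [] then (e a * S (e y)) \<otimes> 1 else 0)"
  proof (intro sum.cong refl, clarify)
    fix a z assume "(a, z) \<in> splits w"
    then have "z \<in> lists A" using splits_lists assms by blast
    then show "(\<Sum>(t, y)\<in>splits z. \<Sum>(b, x)\<in>splits t. G a b x y) =
        (\<Sum>(t, y)\<in>splits z. if t = [] then (e a * S (e y)) \<otimes> 1 else 0)"
      by (intro sum.cong refl) (clarify, rule inner, use splits_lists in blast)
  qed
  also have "\<dots> = (\<Sum>(a, z)\<in>splits w. (e a * S (e z)) \<otimes> 1)"
    by (simp only: sum_splits_empty_left)
  also have "\<dots> = (\<Sum>(a, z)\<in>splits w. e a * S (e z)) \<otimes> 1"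
    by (simp add: case_prod_unfold tensor_sum_left)
  finally show ?thesis by (simp add: antipode_word[OF assms] tensor_zero)
qed

text \<open>
  \<open>\<Delta> \<circ> S\<close> is also a right convolution inverse of \<open>\<Delta>\<close>, because \<open>\<Delta>\<close> is multiplicative.  The two
  convolutions agree in all terms with a nonempty left part by induction, and the remaining
  terms are the two sides of the claim.
\<close>

theorem comult_antipode:
  assumes "w \<in> lists A"
  shows "\<Delta> (S (e w)) = flipped_comult w"
  using assms
proof (induction w rule: length_induct)
  case (1 w)
  show ?case
  proof (cases w)
    case Nil
    then show ?thesis by (simp add: word_Nil antipode_one comult_one flipped_comult_def)
  next
    case (Cons a w')
    have lists: "a # u \<in> lists A" "v \<in> lists A" if "(u, v) \<in> splits w'" for u v
      using that 1(2) splits_lists[of u v w'] by (auto simp: Cons)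
    interpret \<Delta>: Vector_Spaces.linear scale fun_scale \<Delta> by (rule linear_comult)
    let ?rest = "\<Sum>(u, v)\<in>splits w'. braided_mult scale H q (\<Delta> (e (a # u))) (flipped_comult v)"
    have "0 = \<Delta> (\<Sum>(u, v)\<in>splits w. e u * S (e v))"
      by (simp only: antipode_word[OF 1(2)]) (simp add: Cons \<Delta>.zero)
    also have "\<dots> = (\<Sum>(u, v)\<in>splits w. \<Delta> (e u * S (e v)))"
      by (simp add: \<Delta>.sum case_prod_unfold)
    also have "\<dots> = \<Delta> (S (e w)) + (\<Sum>(u, v)\<in>splits w'. \<Delta> (e (a # u) * S (e v)))"
      by (simp add: Cons sum_splits_Cons word_Nil)
    also have "(\<Sum>(u, v)\<in>splits w'. \<Delta> (e (a # u) * S (e v))) = ?rest"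
    proof (intro sum.cong refl, clarify)
      fix u v assume uv: "(u, v) \<in> splits w'"
      then have "length v < length w" by (auto simp: splits_def Cons)
      with 1(1) lists(2)[OF uv]
      show "\<Delta> (e (a # u) * S (e v)) = braided_mult scale H q (\<Delta> (e (a # u))) (flipped_comult v)"
        by (simp add: comult_mult)
    qed
    finally have "0 = \<Delta> (S (e w)) + ?rest" .
    moreover have "braided_mult scale H q (\<Delta> (e [])) (flipped_comult w) = flipped_comult w"
      using braided_mult_flipped_comult[of "[]" w] 1(2) by (simp add: word_Nil flipped_comult_def)
    with convolution_flipped_comult[OF 1(2)] have "flipped_comult w + ?rest = 0"
      by (simp add: Cons sum_splits_Cons)
    ultimately have "\<Delta> (S (e w)) + ?rest = flipped_comult w + ?rest" by simp
    then show ?thesis by (simp only: add_right_cancel)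
  qed
qed

section \<open>Coordinates of the antipode\<close>

lemma coordinates_bilinear:
  "u \<in> lists A \<Longrightarrow> v \<in> lists A \<Longrightarrow> bilinear_map scale scale (*) (\<lambda>y z. \<xi> u y * \<xi> v z)"
  using linear_coordinate[of u] linear_coordinate[of v]
  by (auto simp: bilinear_map_def Vector_Spaces.linear_iff algebra_simps)

lemma sum_tensor_apply: "(\<Sum>i\<in>I. t i) F = (\<Sum>i\<in>I. t i F)" for t :: "_ \<Rightarrow> ('h, 'h, 'k) tensor"
  by (induction I rule: infinite_finite_induct) auto

text \<open>
  A tensor is a function of bilinear forms, so the right-hand side is \<open>(\<xi> [a] \<otimes> \<xi> u) (\<Delta> x)\<close>.  Both
  sides are linear in \<open>x\<close>, hence it suffices to compare them on words.
\<close>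

lemma coordinate_Cons:
  assumes a: "a \<in> A" and u: "u \<in> lists A"
  shows "\<xi> (a # u) x = \<Delta> x (\<lambda>y z. \<xi> [a] y * \<xi> u z)"
proof -
  define F where "F = (\<lambda>y z. \<xi> [a] y * \<xi> u z)"
  have F: "bilinear_map scale scale (*) F"
    unfolding F_def using a u by (intro coordinates_bilinear) auto
  define \<phi> where "\<phi> x = \<xi> (a # u) x - \<Delta> x F" for x
  have "Vector_Spaces.linear scale (*) (\<lambda>x. \<Delta> x F)"
    by (rule linear_compose_functional[OF linear_comult linear_apply])
  then have lin: "Vector_Spaces.linear scale (*) \<phi>"
    using linear_coordinate[of "a # u"] a u
    by (auto simp: \<phi>_def Vector_Spaces.linear_iff algebra_simps)
  have words_zero: "\<phi> (e w) = 0" if w: "w \<in> lists A" for w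
  proof -
    have "\<Delta> (e w) F = (\<Sum>(u', v)\<in>splits w. \<xi> [a] (e u') * \<xi> u (e v))"
      by (simp add: comult_word[OF w] sum_tensor_apply case_prod_unfold tensor_apply[OF F])
         (simp add: F_def)
    also have "\<dots> = (\<Sum>(u', v)\<in>splits w. if u' = [a] then (if v = u then 1 else 0) else 0)"
    proof (intro sum.cong refl, clarify)
      fix u' v assume "(u', v) \<in> splits w"
      then have "u' \<in> lists A" "v \<in> lists A" using splits_lists w by blast+
      then show "\<xi> [a] (e u') * \<xi> u (e v) = (if u' = [a] then (if v = u then 1 else 0) else 0)"
        using a u by (auto simp: coordinate_word)
    qed
    also have "\<dots> = (if w = a # u then 1 else 0)"
    proof (cases w)
      case (Cons b w')
      have "(\<Sum>(u', v)\<in>splits w'. if b # u' = [a] then (if v = u then 1 else 0) else 0) =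
          (\<Sum>(u', v)\<in>splits w'. if u' = [] then (if b = a \<and> v = u then 1 else 0) else (0::'k))"
        by (intro sum.cong) auto
      then show ?thesis by (simp add: Cons sum_splits_Cons sum_splits_empty_left)
    qed simp
    finally show ?thesis using a u w by (simp add: \<phi>_def coordinate_word)
  qed
  have "\<phi> (component n x) = 0" for n
    by (rule functional_zero_on_span[OF lin, of "e ` words n"])
       (use words_zero component(1)[of n x] in \<open>auto simp: words_def component_span\<close>)
  then have "\<phi> (\<Sum>n | component n x \<noteq> 0. scale 1 (component n x)) = 0"
    by (simp only: functional_sum[OF lin]) simp
  then show ?thesis by (simp add: component(3) \<phi>_def F_def)
qed

lemma comp_inv_snoc: "comp_inv (\<alpha> @ [n]) = comp_inv \<alpha> + sum_list \<alpha> * n"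
proof -
  have "comp_inv (\<alpha> @ [n]) = comp_inv \<alpha> + (\<Sum>i<length \<alpha>. \<alpha> ! i * n)"
    by (simp add: comp_inv_def nth_append)
  also have "(\<Sum>i<length \<alpha>. \<alpha> ! i * n) = sum_list \<alpha> * n"
    unfolding sum_list_sum_nth atLeast0LessThan by (rule sum_distrib_right[symmetric])
  finally show ?thesis .
qed

text \<open>
  By \<open>coordinate_Cons\<close> and \<open>comult_antipode\<close>, the coordinate at \<open>a # u\<close> is a sum over the cuts
  \<open>w = x @ y\<close> of \<open>\<xi> [a] (S (e y))\<close> times \<open>\<xi> u (S (e x))\<close>.  The first factor vanishes for empty \<open>y\<close>;
  if \<open>y\<close> has more than one letter, then \<open>x\<close> is shorter than \<open>u\<close> and the second factor vanishes by
  induction.  So only the cut before the last letter of \<open>w\<close> survives.  Words \<open>w\<close> shorter than \<open>u\<close>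
  are included for the sake of this induction.
\<close>

theorem coordinate_antipode:
  assumes "u \<in> lists A" "w \<in> lists A" "length w \<le> length u"
  shows "\<xi> u (S (e w)) = (if u = rev w then (-1) ^ length w * q ^ comp_inv (map d w) else 0)"
  using assms
proof (induction u arbitrary: w rule: list.induct)
  case Nil
  then show ?case by (simp add: word_Nil antipode_one coordinate_word[of "[]" "[]", unfolded word_Nil] comp_inv_def)
next
  case (Cons a u)
  then have a: "a \<in> A" and u: "u \<in> lists A" by auto
  have one: "\<xi> [a] 1 = 0"
    using coordinate_word[of "[a]" "[]"] a by (simp add: word_Nil)
  let ?t = "\<lambda>(x, y). q ^ (weight_of x * weight_of y) * (\<xi> [a] (S (e y)) * \<xi> u (S (e x)))"
  have sum: "\<xi> (a # u) (S (e w)) = (\<Sum>p\<in>splits w. ?t p)"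
    using coordinates_bilinear[of "[a]" u] a u
    by (simp add: coordinate_Cons[OF a u] comult_antipode[OF Cons.prems(2)] flipped_comult_def sum_tensor_apply
        case_prod_unfold fun_scale_apply tensor_apply)
  show ?case
  proof (cases w rule: rev_cases)
    case Nil
    then show ?thesis using sum by (simp add: word_Nil antipode_one one)
  next
    case (snoc w' b)
    have w': "w' \<in> lists A" and b: "b \<in> A" and len: "length w' \<le> length u"
      using Cons.prems by (auto simp: snoc)
    have "?t p = 0" if mem: "p \<in> splits w - {(w', [b])}" for p
    proof -
      obtain x y where p: "p = (x, y)" "x @ y = w" using mem by (cases p) (auto simp: splits_def)
      show ?thesis
      proof (cases y rule: rev_cases)
        case Nil
        then show ?thesis by (simp add: p word_Nil antipode_one one)
      next
        case (snoc y' b')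
        with p \<open>w = w' @ [b]\<close> have eq: "w' = x @ y'" "b' = b" by auto
        with mem p snoc have "y' \<noteq> []" by auto
        with eq len have "length x < length u" by (cases y') auto
        moreover have "x \<in> lists A" using w' eq by simp
        ultimately have "\<xi> u (S (e x)) = 0" using Cons.IH[OF u, of x] by auto
        then show ?thesis by (simp add: p)
      qed
    qed
    then have "(\<Sum>p\<in>splits w. ?t p) = (\<Sum>p\<in>{(w', [b])}. ?t p)"
      by (intro sum.mono_neutral_right finite_splits) (auto simp: splits_def snoc)
    then have "\<xi> (a # u) (S (e w)) = q ^ (weight_of w' * d b) * (\<xi> [a] (S (e [b])) * \<xi> u (S (e w')))"
      unfolding sum by simp
    also have "\<xi> [a] (S (e [b])) = (if a = b then -1 else 0)"
      using a b coordinate_word[of "[a]" "[b]"]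
        module_hom.neg[OF Vector_Spaces.linear.axioms(3)[OF linear_coordinate[of "[a]"]]]
      by (auto simp: antipode_letter)
    finally show ?thesis
      using Cons.IH[OF u w' len]
      by (auto simp: snoc comp_inv_snoc weight_of_def power_add)
  qed
qed

section \<open>Primitive elements\<close>

text \<open>
  Letters are primitive.  Conversely, the coordinate of a primitive \<open>x\<close> at \<open>a # u\<close> with nonempty
  \<open>u\<close> is \<open>\<xi> [a] 1 * \<xi> u x + \<xi> [a] x * \<xi> u 1 = 0\<close>, and the empty word has degree \<open>0\<close>.
\<close>

lemma dim_primitives:
  assumes "n > 0"
  shows "dim (primitives scale \<Delta> \<inter> H n) = card {a \<in> A. d a = n}"
proof -
  define I where "I = (\<lambda>a. [a]) ` {a \<in> A. d a = n}"
  have I: "I \<subseteq> words n" by (auto simp: I_def words_def)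
  have prim_e: "e w \<in> primitives scale \<Delta>" if "w \<in> I" for w
    using that by (auto simp: I_def primitives_def comult_word sum_splits_Cons word_Nil)
  have "subspace (primitives scale \<Delta>)"
    unfolding primitives_def
    using linear_comult linear_tensor_left linear_tensor_right
      module_hom.zero[OF Vector_Spaces.linear.axioms(3)[OF linear_comult]]
    by (intro subspaceI) (auto simp: Vector_Spaces.linear_iff tensor_zero
      fun_scale_def fun_eq_iff algebra_simps)
  then have "subspace (primitives scale \<Delta> \<inter> H n)"
    using subspace_component by (rule subspace_inter)
  then have "span (e ` I) \<subseteq> primitives scale \<Delta> \<inter> H n"
    using prim_e I span_superset[of "e ` words n"] by (intro span_minimal) (auto simp: component_span)
  moreover have "x \<in> span (e ` I)" if x: "x \<in> primitives scale \<Delta> \<inter> H n" for x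
  proof -
    have "\<xi> w x = 0" if w: "w \<in> words n - I" for w
    proof -
      obtain a u where au: "w = a # u"
        using w assms by (cases w) (auto simp: words_def)
      with w have "u \<noteq> []" by (auto simp: I_def words_def)
      have A: "a \<in> A" "u \<in> lists A" using w by (auto simp: au words_def)
      have "\<xi> u 1 = 0" "\<xi> [a] 1 = 0"
        using coordinate_word[of _ "[]"] A \<open>u \<noteq> []\<close> by (simp_all add: word_Nil)
      then show ?thesis
        using x coordinates_bilinear[of "[a]" u] A
        by (simp add: au coordinate_Cons[OF A] primitives_def tensor_apply)
    qed
    then have "(\<Sum>w\<in>words n. scale (\<xi> w x) (e w)) = (\<Sum>w\<in>I. scale (\<xi> w x) (e w))"
      by (intro sum.mono_neutral_right finite_words I) auto
    moreover have "(\<Sum>w\<in>words n. scale (\<xi> w x) (e w)) = x"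
      using x by (intro word_expansion finite_words) (auto simp: words_def component_span)
    ultimately have "x = (\<Sum>w\<in>I. scale (\<xi> w x) (e w))" by simp
    also have "\<dots> \<in> span (e ` I)" by (intro span_sum span_scale span_base) auto
    finally show ?thesis .
  qed
  ultimately have "primitives scale \<Delta> \<inter> H n = span (e ` I)" by blast
  moreover have "dim (span (e ` I)) = card I"
    using I by (intro dim_span_words) (auto simp: words_def)
  moreover have "card I = card {a \<in> A. d a = n}"
    unfolding I_def by (intro card_image) (auto simp: inj_on_def)
  ultimately show ?thesis by simp
qed

end

section \<open>Counting palindromic words\<close>

lemma finite_compositions: "finite (compositions m)"
proof (rule finite_subset)
  show "compositions m \<subseteq> {\<alpha>. set \<alpha> \<subseteq> {..m} \<and> length \<alpha> \<le> m}"
  proof clarify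
    fix \<alpha> assume \<alpha>: "\<alpha> \<in> compositions m"
    have "length \<alpha> \<le> sum_list \<alpha>" if "0 \<notin> set \<alpha>" for \<alpha> :: "nat list"
      using that by (induction \<alpha>) auto
    with \<alpha> show "set \<alpha> \<subseteq> {..m} \<and> length \<alpha> \<le> m"
      using member_le_sum_list[of _ \<alpha>] by (auto simp: compositions_def)
  qed
qed (simp add: finite_lists_length_le)

lemma card_words_with_weights:
  "card {u \<in> lists A. map d u = \<beta>} = (\<Prod>i<length \<beta>. card {a \<in> A. d a = \<beta> ! i})"
proof (induction \<beta>)
  case Nil
  have "{u \<in> lists A. map d u = []} = {[]}" by auto
  then show ?case by simp
next
  case (Cons n \<beta>)
  have "{u \<in> lists A. map d u = n # \<beta>} =
      (\<lambda>(a, u). a # u) ` ({a \<in> A. d a = n} \<times> {u \<in> lists A. map d u = \<beta>})"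
    by (auto simp: map_eq_Cons_conv image_iff)
  then have "card {u \<in> lists A. map d u = n # \<beta>} =
      card {a \<in> A. d a = n} * card {u \<in> lists A. map d u = \<beta>}"
    by (simp add: card_image inj_on_def card_cartesian_product)
  then show ?case by (simp add: Cons prod.lessThan_Suc_shift del: prod.lessThan_Suc)
qed

text \<open>A palindrome is determined by its first half, including the middle letter.\<close>

lemma card_palindromes:
  "card {w \<in> lists A. map d w = \<alpha> \<and> w = rev w} = pal (\<lambda>n. card {a \<in> A. d a = n}) \<alpha>"
proof (cases "\<alpha> = rev \<alpha>")
  case False
  then have empty: "{w \<in> lists A. map d w = \<alpha> \<and> w = rev w} = {}" by (auto simp: rev_map)
  show ?thesis unfolding empty using False by (simp add: pal_def)
next
  case True
  define k where "k = length \<alpha>"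
  define h where "h = (k + 1) div 2"
  have hk: "h \<le> k" "k div 2 \<le> h" "k - k div 2 = h" by (auto simp: h_def)
  \<comment> \<open>\<open>h\<close> is half the length, rounded up, so that the mirrored part must omit the middle letter.\<close>
  have complete: "take h x @ rev (take (k div 2) x) = x" if "rev x = x" "length x = k" for x :: "'x list"
    using that hk rev_take[of "k div 2" x] by simp
  have "bij_betw (take h) {w \<in> lists A. map d w = \<alpha> \<and> w = rev w} {u \<in> lists A. map d u = take h \<alpha>}"
  proof (rule bij_betw_byWitness[where f' = "\<lambda>u. u @ rev (take (k div 2) u)"])
    show "\<forall>w\<in>{w \<in> lists A. map d w = \<alpha> \<and> w = rev w}. take h w @ rev (take (k div 2) (take h w)) = w"
    proof
      fix w assume "w \<in> {w \<in> lists A. map d w = \<alpha> \<and> w = rev w}"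
      then have "rev w = w" "length w = k" by (auto simp: k_def)
      from complete[OF this] show "take h w @ rev (take (k div 2) (take h w)) = w"
        using hk(2) by (simp add: min_absorb1)
    qed
    show "\<forall>u\<in>{u \<in> lists A. map d u = take h \<alpha>}. take h (u @ rev (take (k div 2) u)) = u"
      using hk by (auto simp: k_def dest!: arg_cong[where f = length])
    show "take h ` {w \<in> lists A. map d w = \<alpha> \<and> w = rev w} \<subseteq> {u \<in> lists A. map d u = take h \<alpha>}"
      by (auto simp: take_map dest: in_set_takeD)
    show "(\<lambda>u. u @ rev (take (k div 2) u)) ` {u \<in> lists A. map d u = take h \<alpha>}
        \<subseteq> {w \<in> lists A. map d w = \<alpha> \<and> w = rev w}"
    proof (rule image_subsetI)
      fix u assume "u \<in> {u \<in> lists A. map d u = take h \<alpha>}"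
      then have u: "u \<in> lists A" "map d u = take h \<alpha>" by auto
      let ?w = "u @ rev (take (k div 2) u)"
      have len: "length u = h" using arg_cong[OF u(2), of length] hk by (simp add: k_def)
      have "map d ?w = take h \<alpha> @ rev (take (k div 2) (take h \<alpha>))"
        by (simp add: rev_map[symmetric] take_map[symmetric] u(2))
      also have "\<dots> = \<alpha>" using complete[of \<alpha>] True hk by (simp add: k_def min_absorb1)
      finally have "map d ?w = \<alpha>" .
      moreover have "?w = rev ?w"
      proof -
        have "length (drop (k div 2) u) \<le> 1" by (simp add: len h_def)
        then have "rev (drop (k div 2) u) = drop (k div 2) u"
          by (cases "drop (k div 2) u") auto
        then have "rev u = drop (k div 2) u @ rev (take (k div 2) u)"
          by (metis append_take_drop_id rev_append)
        then show ?thesis by (metis append_assoc append_take_drop_id rev_append rev_rev_ident)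
      qed
      moreover have "?w \<in> lists A" using u(1) set_take_subset[of "k div 2" u] by auto
      ultimately show "?w \<in> {w \<in> lists A. map d w = \<alpha> \<and> w = rev w}" by blast
    qed
  qed
  then have "card {w \<in> lists A. map d w = \<alpha> \<and> w = rev w} = card {u \<in> lists A. map d u = take h \<alpha>}"
    by (rule bij_betw_same_card)
  also have "\<dots> = (\<Prod>i<h. card {a \<in> A. d a = \<alpha> ! i})"
    using hk by (simp add: card_words_with_weights k_def)
  finally show ?thesis using True by (simp add: pal_def h_def k_def)
qed

context cofree_q_hopf_algebra
begin

theorem trace_antipode_formula:
  "subspace_trace scale (H m) S =
    (\<Sum>\<alpha>\<in>compositions m. (-1) ^ length \<alpha> *
      of_nat (pal (\<lambda>n. dim (primitives scale \<Delta> \<inter> H n)) \<alpha>) * q ^ comp_inv \<alpha>)"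
proof -
  have comp: "map d w \<in> compositions m" if "w \<in> words m" for w
    using that letter_weight_pos by (fastforce simp: words_def weight_of_def compositions_def)
  have "subspace_trace scale (H m) S =
      (\<Sum>w\<in>words m. if w = rev w then (-1) ^ length w * q ^ comp_inv (map d w) else 0)"
    unfolding trace_antipode by (intro sum.cong refl coordinate_antipode) (auto simp: words_def)
  also have "\<dots> = (\<Sum>\<alpha>\<in>compositions m. \<Sum>w | w \<in> words m \<and> map d w = \<alpha>.
      if w = rev w then (-1) ^ length w * q ^ comp_inv (map d w) else 0)"
    using comp by (intro sum.group[symmetric] finite_words finite_compositions) auto
  also have "\<dots> = (\<Sum>\<alpha>\<in>compositions m. (-1) ^ length \<alpha> *
      of_nat (pal (\<lambda>n. dim (primitives scale \<Delta> \<inter> H n)) \<alpha>) * q ^ comp_inv \<alpha>)"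
  proof (rule sum.cong[OF refl])
    fix \<alpha> assume \<alpha>: "\<alpha> \<in> compositions m"
    let ?P = "{w \<in> lists A. map d w = \<alpha> \<and> w = rev w}"
    have words: "{w. w \<in> words m \<and> map d w = \<alpha>} = {w \<in> lists A. map d w = \<alpha>}"
      using \<alpha> by (auto simp: words_def weight_of_def compositions_def)
    then have fin: "finite {w \<in> lists A. map d w = \<alpha>}"
      using finite_subset[OF _ finite_words[of m]] by (metis (no_types, lifting) mem_Collect_eq subsetI)
    have "(\<Sum>w | w \<in> words m \<and> map d w = \<alpha>.
        if w = rev w then (-1) ^ length w * q ^ comp_inv (map d w) else 0) =
      (\<Sum>w\<in>?P. (-1) ^ length \<alpha> * q ^ comp_inv \<alpha>)"
      unfolding words using fin by (intro sum.mono_neutral_cong_right) auto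
    also have "\<dots> = (-1) ^ length \<alpha> * of_nat (pal (\<lambda>n. card {a \<in> A. d a = n}) \<alpha>) * q ^ comp_inv \<alpha>"
      by (simp add: card_palindromes)
    also have "pal (\<lambda>n. card {a \<in> A. d a = n}) \<alpha> = pal (\<lambda>n. dim (primitives scale \<Delta> \<inter> H n)) \<alpha>"
    proof -
      have "\<alpha> ! i > 0" if "i < (length \<alpha> + 1) div 2" for i
      proof -
        have "\<alpha> ! i \<in> set \<alpha>" using that by (intro nth_mem) auto
        with \<alpha> show ?thesis by (auto simp: compositions_def intro: gr0I)
      qed
      then show ?thesis by (simp add: pal_def dim_primitives)
    qed
    finally show "(\<Sum>w | w \<in> words m \<and> map d w = \<alpha>.
        if w = rev w then (-1) ^ length w * q ^ comp_inv (map d w) else 0) =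
      (-1) ^ length \<alpha> * of_nat (pal (\<lambda>n. dim (primitives scale \<Delta> \<inter> H n)) \<alpha>) * q ^ comp_inv \<alpha>" .
  qed
  finally show ?thesis .
qed

end

section \<open>Words in a homogeneous basis\<close>

text \<open>
  The product form \<open>c a\<^sub>1 \<otimes> \<dots> \<otimes> c a\<^sub>k\<close> on words of length \<open>k\<close>, extended by \<open>0\<close> to the other lengths.
  Words are functions of multilinear forms, so evaluating them at these forms gives the
  coordinates when \<open>c\<close> is dual to the alphabet.
\<close>

primrec word_form :: "('a \<Rightarrow> 'v \<Rightarrow> 'k::field) \<Rightarrow> 'a list \<Rightarrow> 'v list \<Rightarrow> 'k" where
  "word_form c [] w = (if w = [] then 1 else 0)"
| "word_form c (a # u) w = (case w of [] \<Rightarrow> 0 | x # w' \<Rightarrow> c a x * word_form c u w')"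

lemma multilinear_word_form:
  assumes sV: "vector_space sV"
    and c: "\<And>a. a \<in> set u \<Longrightarrow> Vector_Spaces.linear sV (*) (c a)"
  shows "multilinear_map sV (*) (word_form c u)"
  unfolding multilinear_map_def
proof (intro allI)
  fix us ws
  show "Vector_Spaces.linear sV (*) (\<lambda>x. word_form c u (us @ x # ws))"
    using c
  proof (induction u arbitrary: us)
    case Nil
    then show ?case using sV vector_space_field by (simp add: Vector_Spaces.linear_iff)
  next
    case (Cons a u)
    then have "Vector_Spaces.linear sV (*) (c a)" "\<And>us. Vector_Spaces.linear sV (*) (\<lambda>x. word_form c u (us @ x # ws))"
      by auto
    then show ?case by (cases us) (auto simp: Vector_Spaces.linear_iff algebra_simps)
  qed
qed

lemma word_form_dual:
  assumes "\<And>a b. a \<in> A \<Longrightarrow> b \<in> A \<Longrightarrow> c a b = (if a = b then 1 else 0)" "u \<in> lists A" "w \<in> lists A"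
  shows "word_form c u w = (if u = w then 1 else 0)"
  using assms(2,3)
proof (induction u arbitrary: w rule: list.induct)
  case (Cons a u)
  then show ?case using assms(1) by (cases w) auto
qed auto

context graded_vector_space
begin

text \<open>
  \<open>A\<close> is a union of bases of the components, and \<open>c a\<close> reads off the coefficient of \<open>a\<close> in the
  component of degree \<open>degree_of H a\<close>.
\<close>

lemma homogeneous_basis:
  obtains A c where
    "\<And>n. H n = span {a \<in> A. degree_of H a = n}"
    "\<And>a. a \<in> A \<Longrightarrow> Vector_Spaces.linear scale (*) (c a)"
    "\<And>a b. a \<in> A \<Longrightarrow> b \<in> A \<Longrightarrow> c a b = (if a = b then 1 else 0)"
proof -
  have "\<exists>B. B \<subseteq> H n \<and> independent B \<and> H n \<subseteq> span B" for n
    by (rule maximal_independent_subset[of "H n"]) blast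
  then obtain B where B: "\<And>n. B n \<subseteq> H n" "\<And>n. independent (B n)" "\<And>n. H n \<subseteq> span (B n)"
    by metis
  have span_B: "span (B n) = H n" for n
    using B(1,3)[of n] span_minimal[OF _ subspace_component[of n]] by blast
  define A where "A = (\<Union>n. B n)"
  define c where "c a x = representation (B (degree_of H a)) (component (degree_of H a) x) a" for a x
  have deg: "degree_of H a = n" if "a \<in> B n" for a n
    using that B(1,2)[of n] dependent_zero[of "B n"] by (intro degree_of_eq) auto
  have letters: "{a \<in> A. degree_of H a = n} = B n" for n
    using deg by (auto simp: A_def)
  show ?thesis
  proof
    show "H n = span {a \<in> A. degree_of H a = n}" for n by (simp add: letters span_B)
    show "Vector_Spaces.linear scale (*) (c a)" for a
      using vector_space_axioms vector_space_field component(1) span_B B(2)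
      by (simp add: Vector_Spaces.linear_iff c_def component_add component_scale
          representation_add representation_scale)
    show "c a b = (if a = b then 1 else 0)" if "a \<in> A" "b \<in> A" for a b
    proof -
      have ab: "a \<in> B (degree_of H a)" "b \<in> B (degree_of H b)" using that deg by (auto simp: A_def)
      then have "component (degree_of H a) b = (if degree_of H a = degree_of H b then b else 0)"
        using B(1) by (intro component_homogeneous) auto
      with ab show ?thesis
        using representation_basis[OF B(2) ab(1)] representation_basis[OF B(2), of b "degree_of H a"]
        by (auto simp: c_def representation_zero)
    qed
  qed
qed

text \<open>
  Expand the letters of a word in the basis one by one: \<open>us\<close> is the part already treated, \<open>ws\<close> the
  part still to be expanded.
\<close>

lemma word_degree_basis:
  assumes A: "\<And>n. H n = span {a \<in> A. degree_of H a = n}"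
  shows "word_degree scale H m =
    module.span fun_scale (word scale ` {w \<in> lists A. sum_list (map (degree_of H) w) = m})"
proof -
  let ?W = "word scale ` {w \<in> lists A. sum_list (map (degree_of H) w) = m}"
  interpret F: vector_space "fun_scale :: 'k \<Rightarrow> ('h, 'k) word_tensor \<Rightarrow> _"
    by (rule vector_space_fun_scale)
  have mem: "a \<in> H (degree_of H a)" if "a \<in> A" for a
    by (subst A) (rule span_base, simp add: that)
  have expand: "word scale (us @ ws) \<in> F.span ?W"
    if "us \<in> lists A" "list_all2 (\<lambda>x n. x \<in> H n) ws ns" "sum_list (map (degree_of H) us) + sum_list ns = m"
    for us ws ns
    using that
  proof (induction ws arbitrary: us ns)
    case Nil
    then show ?case by (intro F.span_base imageI) auto
  next
    case (Cons x ws)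
    then obtain n ns' where ns: "ns = n # ns'" "x \<in> H n" "list_all2 (\<lambda>x n. x \<in> H n) ws ns'"
      by (auto simp: list_all2_Cons1)
    interpret L: Vector_Spaces.linear scale fun_scale "\<lambda>x. word scale (us @ x # ws)"
      using multilinear_word[OF vector_space_axioms] by (simp add: multilinear_map_def)
    from ns(2) have "x \<in> span {a \<in> A. degree_of H a = n}" using A by simp
    then show ?case
    proof (induction rule: span_induct_alt)
      case base
      show ?case unfolding L.zero by (rule F.span_zero)
    next
      case (step r a y)
      then have "word scale ((us @ [a]) @ ws) \<in> F.span ?W"
        using Cons.prems ns by (intro Cons.IH[of _ ns']) auto
      then have "word scale (us @ a # ws) \<in> F.span ?W" by simp
      with step(2) show ?case unfolding L.add L.scale by (intro F.span_add F.span_scale)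
    qed
  qed
  show ?thesis
    unfolding word_degree_def
  proof (rule antisym; rule F.span_minimal[OF _ F.subspace_span])
    show "{word scale w |w ns. list_all2 (\<lambda>x n. x \<in> H n) w ns \<and> sum_list ns = m} \<subseteq> F.span ?W"
    proof
      fix t assume "t \<in> {word scale w |w ns. list_all2 (\<lambda>x n. x \<in> H n) w ns \<and> sum_list ns = m}"
      then obtain w ns where w: "t = word scale w" "list_all2 (\<lambda>x n. x \<in> H n) w ns" "sum_list ns = m" by blast
      with expand[of "[]" w ns] show "t \<in> F.span ?W" by simp
    qed
    show "?W \<subseteq> F.span {word scale w |w ns. list_all2 (\<lambda>x n. x \<in> H n) w ns \<and> sum_list ns = m}"
    proof (rule image_subsetI, rule F.span_base)
      fix w assume "w \<in> {w \<in> lists A. sum_list (map (degree_of H) w) = m}"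
      moreover from this have "list_all2 (\<lambda>x n. x \<in> H n) w (map (degree_of H) w)"
        using mem by (auto simp: list_all2_map2 list_all2_same)
      ultimately show "word scale w \<in> {word scale w |w ns. list_all2 (\<lambda>x n. x \<in> H n) w ns \<and> sum_list ns = m}"
        by (intro CollectI exI[of _ w] exI[of _ "map (degree_of H) w"]) simp
    qed
  qed
qed

end

text \<open>
  Since \<open>f\<close> has a linear left inverse \<open>g\<close>, the map \<open>f \<otimes> f\<close> is injective on tensors: apply
  \<open>g \<otimes> g\<close>.  For \<open>t = \<Delta> (e w)\<close> this turns a coalgebra morphism to the deconcatenation coalgebra
  into a formula for \<open>\<Delta>\<close>.
\<close>

lemma comult_pullback:
  assumes s: "vector_space s" and f: "Vector_Spaces.linear s fun_scale f" "inj f"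
    and f_e: "\<And>w. f (e w) = word sV w"
    and t: "t = (\<Sum>i\<in>I. tensor s s (x i) (y i))" "finite I"
    and iso: "deconcatenation sV (word sV w) = tensor_map s s fun_scale fun_scale f f t"
    and sV: "vector_space sV"
  shows "t = (\<Sum>(u, v)\<in>splits w. tensor s s (e u) (e v))"
proof -
  interpret vector_space_pair s fun_scale
    using s vector_space_fun_scale by (simp add: vector_space_pair_def)
  obtain g where g: "Vector_Spaces.linear fun_scale s g" "g \<circ> f = id"
    using linear_injective_left_inverse[OF f] by blast
  have gf: "g (f z) = z" for z using g(2) by (metis comp_apply id_apply)
  have "(\<Sum>i\<in>I. tensor fun_scale fun_scale (f (x i)) (f (y i))) =
      tensor_map s s fun_scale fun_scale f f t"
    unfolding t(1) by (rule tensor_map_sum[OF t(2) f(1) f(1), symmetric])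
  also have "\<dots> = deconcatenation sV (lin_comb fun_scale (word sV) [(1, w)])"
    by (simp add: iso[symmetric] lin_comb_def)
  also have "\<dots> = (\<Sum>(u, v)\<in>splits w. tensor fun_scale fun_scale (f (e u)) (f (e v)))"
    unfolding deconcatenation_eq[OF sV]
    by (simp add: lin_comb_def f_e sum_take_drop[where F = "\<lambda>u v. tensor fun_scale fun_scale (word sV u) (word sV v)"])
  finally have "tensor_map fun_scale fun_scale s s g g (\<Sum>i\<in>I. tensor fun_scale fun_scale (f (x i)) (f (y i))) =
      tensor_map fun_scale fun_scale s s g g (\<Sum>p\<in>splits w. tensor fun_scale fun_scale (f (e (fst p))) (f (e (snd p))))"
    by (simp add: case_prod_unfold)
  then show ?thesis
    using t by (simp add: tensor_map_sum[OF _ g(1) g(1)] gf case_prod_unfold)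
qed

lemma (in vector_space) pure_tensor_sum:
  assumes "t \<in> module.span fun_scale (range (\<lambda>(x, y). tensor scale scale x y))"
  obtains n :: nat and x y where "t = (\<Sum>i<n. tensor scale scale (x i) (y i))"
proof -
  interpret F: vector_space "fun_scale :: 'a \<Rightarrow> ('b, 'b, 'a) tensor \<Rightarrow> _"
    by (rule vector_space_fun_scale)
  have "\<exists>n x y. t = (\<Sum>i<(n::nat). tensor scale scale (x i) (y i))"
    using assms
  proof (induction rule: F.span_induct_alt)
    case base
    show ?case by (rule exI[of _ 0]) simp
  next
    case (step c p t)
    then obtain n x y where t: "t = (\<Sum>i<(n::nat). tensor scale scale (x i) (y i))" by blast
    obtain a b where p: "p = tensor scale scale a b" using step by auto
    have "fun_scale c p + t = (\<Sum>i<Suc n. tensor scale scale ((x(n := scale c a)) i) ((y(n := b)) i))"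
      using linear_tensor_left[of b] by (simp add: t p Vector_Spaces.linear_iff add.commute)
    then show ?case by blast
  qed
  then show ?thesis using that by blast
qed

lemma (in graded_coalgebra) comult_in_span:
  "\<Delta> h \<in> module.span fun_scale (range (\<lambda>(x, y). tensor scale scale x y))"
proof -
  interpret F: vector_space "fun_scale :: 'k \<Rightarrow> ('h, 'h, 'k) tensor \<Rightarrow> _"
    by (rule vector_space_fun_scale)
  interpret \<Delta>: Vector_Spaces.linear scale fun_scale \<Delta> by (rule linear_comult)
  have "\<Delta> (component n h) \<in> F.span (range (\<lambda>(x, y). tensor scale scale x y))" for n
    using comult_degree[OF component(1)] by (rule rev_subsetD) (rule F.span_mono, auto)
  then have "\<Delta> (\<Sum>n | component n h \<noteq> 0. component n h) \<in> F.span (range (\<lambda>(x, y). tensor scale scale x y))"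
    unfolding \<Delta>.sum by (intro F.span_sum)
  then show ?thesis by (simp add: component(3))
qed

lemma cofree_q_hopf_algebra_exists:
  assumes hopf: "q_hopf_algebra scale H \<Delta> \<epsilon> q S"
    and connected: "vector_space.dim scale (H 0) = 1"
    and finite_dimensional: "\<And>n. \<exists>B. finite B \<and> module.span scale B = H n"
    and graded: "graded_vector_space scaleV V"
    and cofree: "deconcatenation_iso scale H \<Delta> \<epsilon> scaleV V f"
  obtains A e \<xi> where "cofree_q_hopf_algebra scale H \<Delta> \<epsilon> q S A (degree_of V) e \<xi>"
proof -
  interpret q_hopf_algebra scale H \<Delta> \<epsilon> q S by fact
  interpret V: graded_vector_space scaleV V by fact
  interpret F: vector_space "fun_scale :: 'a \<Rightarrow> ('c, 'a) word_tensor \<Rightarrow> _"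
    by (rule vector_space_fun_scale)
  obtain A c where A: "\<And>n. V n = V.span {a \<in> A. degree_of V a = n}"
    and lin_c: "\<And>a. a \<in> A \<Longrightarrow> Vector_Spaces.linear scaleV (*) (c a)"
    and dual_c: "\<And>a b. a \<in> A \<Longrightarrow> b \<in> A \<Longrightarrow> c a b = (if a = b then 1 else 0)"
    by (rule V.homogeneous_basis) blast
  from cofree have lin_f: "Vector_Spaces.linear scale fun_scale f"
    and bij_f: "bij_betw f UNIV (F.span (range (word scaleV)))"
    and deg_f: "\<And>n. f ` H n = word_degree scaleV V n"
    and comult_f: "\<And>x. deconcatenation scaleV (f x) = tensor_map scale scale fun_scale fun_scale f f (\<Delta> x)"
    and counit_f: "\<And>x. word_counit scaleV (f x) = \<epsilon> x"
    by (auto simp: deconcatenation_iso_def)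
  interpret f: Vector_Spaces.linear scale fun_scale f by (rule lin_f)
  have inj_f: "inj f" using bij_f by (simp add: bij_betw_def)
  define e where "e w = inv f (word scaleV w)" for w
  have f_e: "f (e w) = word scaleV w" for w
    using bij_f F.span_base[of "word scaleV w" "range (word scaleV)"]
    by (auto simp: e_def bij_betw_def intro!: f_inv_into_f)
  define \<xi> where "\<xi> u x = f x (word_form c u)" for u x
  have "cofree_q_hopf_algebra scale H \<Delta> \<epsilon> q S A (degree_of V) e \<xi>"
  proof (intro cofree_q_hopf_algebra.intro cofree_q_hopf_algebra_axioms.intro hopf)
    show "dim (H 0) = 1" by (rule connected)
    show "\<exists>B. finite B \<and> span B = H n" for n by (rule finite_dimensional)
    show "H n = span (e ` {w \<in> lists A. sum_list (map (degree_of V) w) = n})" for n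
    proof -
      have "f ` H n = f ` span (e ` {w \<in> lists A. sum_list (map (degree_of V) w) = n})"
        unfolding f.span_image[symmetric] deg_f V.word_degree_basis[OF A]
        by (simp add: image_image f_e)
      with inj_f show ?thesis by (simp add: inj_image_eq_iff)
    qed
    show "\<Delta> (e w) = (\<Sum>(u, v)\<in>splits w. tensor scale scale (e u) (e v))" for w
    proof -
      obtain n :: nat and x y where "\<Delta> (e w) = (\<Sum>i<n. tensor scale scale (x i) (y i))"
        by (rule pure_tensor_sum[OF comult_in_span])
      moreover have "deconcatenation scaleV (word scaleV w) =
          tensor_map scale scale fun_scale fun_scale f f (\<Delta> (e w))"
        by (simp add: comult_f[symmetric] f_e)
      ultimately show ?thesis
        using comult_pullback[where e = e, OF vector_space_axioms lin_f inj_f f_e _ finite_lessThan _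
            V.vector_space_axioms] by blast
    qed
    show "\<epsilon> (e w) = (if w = [] then 1 else 0)" for w
      using word_counit_eq[OF V.vector_space_axioms, of "[(1, w)]"]
      by (simp add: counit_f[symmetric] f_e lin_comb_def)
    show "Vector_Spaces.linear scale (*) (\<xi> w)" for w
      unfolding \<xi>_def by (rule linear_compose_functional[OF lin_f linear_apply])
    show "\<xi> u (e w) = (if u = w then 1 else 0)" if "u \<in> lists A" "w \<in> lists A" for u w
    proof -
      have "multilinear_map scaleV (*) (word_form c u)"
        using that by (intro multilinear_word_form V.vector_space_axioms lin_c) auto
      then show ?thesis
        using word_form_dual[OF dual_c that] by (simp add: \<xi>_def f_e word_def)
    qed
  qed
  then show ?thesis by (rule that)
qed

section \<open>The trace of the antipode\<close>

theorem corollary34: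
  fixes q :: "'k::field_char_0"
    and scale :: "'k \<Rightarrow> 'h::ring_1 \<Rightarrow> 'h"
    and H :: "nat \<Rightarrow> 'h set"
    and \<Delta> :: "'h \<Rightarrow> ('h, 'h, 'k) tensor"
    and \<epsilon> :: "'h \<Rightarrow> 'k"
    and S :: "'h \<Rightarrow> 'h"
    and scaleV :: "'k \<Rightarrow> 'v::ab_group_add \<Rightarrow> 'v"
    and V :: "nat \<Rightarrow> 'v set"
    and m :: nat
  assumes hopf: "q_hopf_algebra scale H \<Delta> \<epsilon> q S"
    and connected: "vector_space.dim scale (H 0) = 1"
    and finite_dimensional: "\<And>n. \<exists>B. finite B \<and> module.span scale B = H n"
    and graded: "graded_vector_space scaleV V"
    and cofree: "\<exists>f. deconcatenation_iso scale H \<Delta> \<epsilon> scaleV V f"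
  shows "subspace_trace scale (H m) S =
    (\<Sum>\<alpha>\<in>compositions m.
      (-1) ^ length \<alpha> *
      of_nat (pal (\<lambda>n. vector_space.dim scale (primitives scale \<Delta> \<inter> H n)) \<alpha>) *
      q ^ comp_inv \<alpha>)"
proof -
  obtain f where "deconcatenation_iso scale H \<Delta> \<epsilon> scaleV V f" using cofree by blast
  from cofree_q_hopf_algebra_exists[OF hopf connected finite_dimensional graded this]
  obtain A e \<xi> where "cofree_q_hopf_algebra scale H \<Delta> \<epsilon> q S A (degree_of V) e \<xi>" by blast
  then show ?thesis by (rule cofree_q_hopf_algebra.trace_antipode_formula)
qed

end
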